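(* Let $K$ be a field, let $n\geq 3$ be an integer, let $S=K[x_1,\ldots,x_n]$, and let $J_n=(x_1x_2,\,x_2x_3,\ldots,x_{n-1}x_n,\,x_nx_1)\subset S$ be the edge ideal of the $n$-cycle graph. Then $$\operatorname{depth}(S/J_n)=\left\lceil \frac{n-1}{3}\right\rceil.$$
   Context: Here $\operatorname{depth}$ denotes the depth of a finitely generated graded $S$-module with respect to the graded maximal ideal $(x_1,\ldots,x_n)$. *)

theory Defs
  imports
    "HOL-Library.Poly_Mapping"
    "HOL-Library.Extended_Nat"
    "HOL-Algebra.QuotRing"
    "HOL-Algebra.Module"
begin

section \<open>Polynomial rings\<close>

text \<open>
  A polynomial with coefficients in \<open>'k\<close> is a finitely supported function from exponent vectors
  to \<open>'k\<close>, and an exponent vector is a finitely supported function from variable indices to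
  exponents.  Multiplication of such functions is convolution.  The ring \<open>K[x\<^sub>1,\<dots>,x\<^sub>n]\<close> consists
  of the polynomials all of whose monomials only involve the indices \<open>1,\<dots>,n\<close>.
\<close>

type_synonym 'k mpolynomial = "(nat \<Rightarrow>\<^sub>0 nat) \<Rightarrow>\<^sub>0 'k"

definition mpoly_ring :: "nat \<Rightarrow> 'k::field mpolynomial ring" where
  "mpoly_ring n =
    \<lparr>carrier = {p. \<forall>m \<in> Poly_Mapping.keys p. Poly_Mapping.keys m \<subseteq> {1..n}},
     mult = (*), one = 1, zero = 0, add = (+)\<rparr>"

definition mvar :: "nat \<Rightarrow> 'k::field mpolynomial" where
  "mvar i = Poly_Mapping.single (Poly_Mapping.single i 1) 1"

definition graded_max_ideal :: "nat \<Rightarrow> 'k::field mpolynomial set" where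
  "graded_max_ideal n = Idl\<^bsub>mpoly_ring n\<^esub> {mvar i | i. i \<in> {1..n}}"

definition cycle_edge_ideal :: "nat \<Rightarrow> 'k::field mpolynomial set" where
  "cycle_edge_ideal n =
    Idl\<^bsub>mpoly_ring n\<^esub> ({mvar i * mvar (i + 1) | i. i \<in> {1..<n}} \<union> {mvar n * mvar 1})"


section \<open>Quotient modules and depth\<close>

definition regular_module :: "('a, 'm) ring_scheme \<Rightarrow> ('a, 'a) module" where
  "regular_module R =
    \<lparr>carrier = carrier R, mult = mult R, one = one R, zero = zero R, add = add R, smult = mult R\<rparr>"

text \<open>
  The library's record of modules extends the record of rings, so \<open>M Quot N\<close> makes sense for
  a submodule \<open>N\<close> of \<open>M\<close>; its additive part is the quotient group.  The fields \<open>mult\<close> and \<open>one\<close>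
  play no role in the module structure.
\<close>

definition quot_module :: "('a, 'b) module \<Rightarrow> 'b set \<Rightarrow> ('a, 'b set) module" where
  "quot_module M N =
    ring.extend (M Quot N) (module.fields (\<lambda>r X. \<Union>x\<in>X. N +>\<^bsub>M\<^esub> (r \<odot>\<^bsub>M\<^esub> x)))"

text \<open>The submodule \<open>(a\<^sub>1,\<dots>,a\<^sub>k) M\<close> of \<open>M\<close> for a list \<open>as = [a\<^sub>1,\<dots>,a\<^sub>k]\<close> of ring elements.\<close>

definition list_smult :: "('a, 'b) module \<Rightarrow> 'a list \<Rightarrow> 'b set" where
  "list_smult M as =
    {\<Oplus>\<^bsub>M\<^esub> i\<in>{..<length as}. (as ! i) \<odot>\<^bsub>M\<^esub> f i | f. f \<in> {..<length as} \<rightarrow> carrier M}"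

definition nonzerodivisor_on :: "'a \<Rightarrow> ('a, 'b) module \<Rightarrow> bool" where
  "nonzerodivisor_on a M \<longleftrightarrow> (\<forall>x \<in> carrier M. a \<odot>\<^bsub>M\<^esub> x = \<zero>\<^bsub>M\<^esub> \<longrightarrow> x = \<zero>\<^bsub>M\<^esub>)"

definition regular_sequence :: "('a, 'm) ring_scheme \<Rightarrow> ('a, 'b) module \<Rightarrow> 'a list \<Rightarrow> bool" where
  "regular_sequence R M as \<longleftrightarrow>
    set as \<subseteq> carrier R \<and>
    (\<forall>i < length as. nonzerodivisor_on (as ! i) (quot_module M (list_smult M (take i as)))) \<and>
    carrier (quot_module M (list_smult M as)) \<noteq> {\<zero>\<^bsub>quot_module M (list_smult M as)\<^esub>}"

text \<open>
  The depth of \<open>M\<close> with respect to \<open>I\<close> is the supremum of the lengths of the \<open>M\<close>-regular sequences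
  in \<open>I\<close>.  It is taken in the extended natural numbers, so that unbounded lengths give \<open>\<infinity>\<close>.
\<close>

definition depth :: "('a, 'm) ring_scheme \<Rightarrow> 'a set \<Rightarrow> ('a, 'b) module \<Rightarrow> enat" where
  "depth R I M = Sup {enat (length as) | as. set as \<subseteq> I \<and> regular_sequence R M as}"

end

theory Submission
  imports Defs
begin

text \<open>
  Upper bound.  If the Koszul cohomology of \<open>S/I\<close> with respect to \<open>x\<^sub>1, \<dots>, x\<^sub>n\<close> is nonzero in degree
  \<open>k + 1\<close> and \<open>a\<close> in the maximal ideal is regular on \<open>S/I\<close>, then \<open>a\<close> annihilates the cohomology, and the
  connecting homomorphism yields a nonzero class of degree \<open>k\<close> over \<open>S/(I + aS)\<close>.  So a regular
  sequence is no longer than the degree of a nonzero class.  In multidegree \<open>x\<^sub>T\<close> the Koszul complex of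
  \<open>S/J\<^sub>n\<close> is the augmented cochain complex of the independence complex of the cycle, in which an explicit
  cocycle is detected by an explicit cross-polytope.

  Lower bound.  A sequence that is weakly regular on \<open>S/(I : x\<^sub>v)\<close> and on \<open>S/(I + x\<^sub>v S)\<close> is weakly
  regular on \<open>S/I\<close>.  Applied to suitable vertices \<open>v\<close>, this reduces \<open>J\<^sub>n\<close> to ideals generated by
  variables, whose complements are independent sets that dominate the vertices \<open>1, \<dots>, n - 1\<close>.  The
  regular sequence consists of linear forms that stay linearly independent on each such set.
\<close>

section \<open>Weakly regular sequences\<close>

text \<open>Both bounds count in threes. A vertex dominates at most three vertices, so a set
  dominating 1, ..., n - 1 has at least ceil((n - 1)/3) elements; this is the room that a leaf of
  the recursion has for linear forms. On the other side, each pair of the cross-polytope takes two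
  vertices and needs a gap before the next pair. A list of length k is a simplex of dimension k - 1,
  which is why a sphere of dimension d - 1 bounds the depth by d. For n = 3d - 1, d pairs leave no
  gap between n and 1; hence the separate cocycle when n mod 3 = 2.

  The colon argument requires one sequence for both pieces, hence for all leaves at once, and over a
  finite field generic linear forms may not exist. So the forms are explicit, with coefficients 0
  and 1, and their independence on a leaf is deduced from domination alone. For the upper bound, the
  homology of the complex is not computed: one explicit cocycle that is not a coboundary
  suffices.\<close>

locale comm_subring =
  fixes S :: "'a::comm_ring_1 set"
  assumes one_mem: "1 \<in> S"
    and add_mem: "a \<in> S \<Longrightarrow> b \<in> S \<Longrightarrow> a + b \<in> S"
    and uminus_mem: "a \<in> S \<Longrightarrow> - a \<in> S"
    and mult_mem: "a \<in> S \<Longrightarrow> b \<in> S \<Longrightarrow> a * b \<in> S"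
begin

lemma diff_mem: "a \<in> S \<Longrightarrow> b \<in> S \<Longrightarrow> a - b \<in> S"
  using add_mem[of a "- b"] uminus_mem by simp

lemma zero_mem: "0 \<in> S"
  using diff_mem[OF one_mem one_mem] by simp

lemma sum_mem: "(\<And>i. i \<in> A \<Longrightarrow> f i \<in> S) \<Longrightarrow> sum f A \<in> S"
  by (induction A rule: infinite_finite_induct) (auto intro: zero_mem add_mem)

definition is_ideal :: "'a set \<Rightarrow> bool" where
  "is_ideal I \<longleftrightarrow> I \<subseteq> S \<and> 0 \<in> I \<and> (\<forall>a\<in>I. \<forall>b\<in>I. a + b \<in> I) \<and> (\<forall>r\<in>S. \<forall>a\<in>I. r * a \<in> I)"

definition adjoin :: "'a set \<Rightarrow> 'a \<Rightarrow> 'a set" where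
  "adjoin I a = {y + a * r | y r. y \<in> I \<and> r \<in> S}"

text \<open>Regularity on S/I in terms of ideals of S, so that the inductions form no quotients.
  That the last quotient is nonzero is a separate test,
  \<open>1 \<notin> foldl adjoin I as\<close>.\<close>

fun weakly_regular :: "'a set \<Rightarrow> 'a list \<Rightarrow> bool" where
  "weakly_regular I [] \<longleftrightarrow> True"
| "weakly_regular I (a # as) \<longleftrightarrow>
     (\<forall>z\<in>S. a * z \<in> I \<longrightarrow> z \<in> I) \<and> weakly_regular (adjoin I a) as"

lemma is_idealD:
  assumes "is_ideal I"
  shows "a \<in> I \<Longrightarrow> a \<in> S" "0 \<in> I" "a \<in> I \<Longrightarrow> b \<in> I \<Longrightarrow> a + b \<in> I"
    "r \<in> S \<Longrightarrow> a \<in> I \<Longrightarrow> r * a \<in> I" "r \<in> S \<Longrightarrow> a \<in> I \<Longrightarrow> a * r \<in> I"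
  using assms by (auto simp: is_ideal_def mult.commute[of a r])

lemma is_ideal_uminus: "is_ideal I \<Longrightarrow> a \<in> I \<Longrightarrow> - a \<in> I"
  using is_idealD(4)[of I "- 1" a] uminus_mem[OF one_mem] by simp

lemma is_ideal_diff: "is_ideal I \<Longrightarrow> a \<in> I \<Longrightarrow> b \<in> I \<Longrightarrow> a - b \<in> I"
  using is_idealD(3)[of I a "- b"] is_ideal_uminus by simp

lemma is_ideal_sum: "is_ideal I \<Longrightarrow> (\<And>i. i \<in> A \<Longrightarrow> f i \<in> I) \<Longrightarrow> sum f A \<in> I"
  by (induction A rule: infinite_finite_induct) (auto dest: is_idealD)

lemma adjoinI: "y \<in> I \<Longrightarrow> r \<in> S \<Longrightarrow> y + a * r \<in> adjoin I a"
  by (auto simp: adjoin_def)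

lemma adjoinE:
  assumes "z \<in> adjoin I a"
  obtains y r where "y \<in> I" "r \<in> S" "z = y + a * r"
  using assms by (auto simp: adjoin_def)

lemma subset_adjoin: "I \<subseteq> adjoin I a"
  using adjoinI[OF _ zero_mem] by fastforce

lemma mem_adjoin: "is_ideal I \<Longrightarrow> a \<in> adjoin I a"
  using adjoinI[OF is_idealD(2) one_mem, of I a] by simp

lemma is_ideal_adjoin:
  assumes I: "is_ideal I" and a: "a \<in> S"
  shows "is_ideal (adjoin I a)"
  unfolding is_ideal_def
proof (intro conjI ballI)
  show "adjoin I a \<subseteq> S"
    using is_idealD(1)[OF I] a by (auto simp: adjoin_def intro: add_mem mult_mem)
  show "0 \<in> adjoin I a"
    using subset_adjoin is_idealD(2)[OF I] by blast
next
  fix u v assume "u \<in> adjoin I a" "v \<in> adjoin I a"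
  then obtain y r y' r' where *: "y \<in> I" "r \<in> S" "u = y + a * r" "y' \<in> I" "r' \<in> S" "v = y' + a * r'"
    by (auto simp: adjoin_def)
  have "(y + y') + a * (r + r') \<in> adjoin I a"
    using * by (intro adjoinI is_idealD(3)[OF I] add_mem)
  then show "u + v \<in> adjoin I a"
    by (simp add: * algebra_simps)
next
  fix s u assume s: "s \<in> S" and "u \<in> adjoin I a"
  then obtain y r where *: "y \<in> I" "r \<in> S" "u = y + a * r"
    by (auto simp: adjoin_def)
  have "s * y + a * (s * r) \<in> adjoin I a"
    using * s by (intro adjoinI is_idealD(4)[OF I] mult_mem)
  then show "s * u \<in> adjoin I a"
    by (simp add: * algebra_simps)
qed

lemma weakly_regular_iff_nth:
  "weakly_regular I as \<longleftrightarrow>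
    (\<forall>i<length as. \<forall>z\<in>S. as ! i * z \<in> foldl adjoin I (take i as) \<longrightarrow> z \<in> foldl adjoin I (take i as))"
  by (induction as arbitrary: I) (simp_all add: All_less_Suc2)

lemma is_ideal_foldl_adjoin: "is_ideal I \<Longrightarrow> set as \<subseteq> S \<Longrightarrow> is_ideal (foldl adjoin I as)"
  by (induction as arbitrary: I) (auto intro: is_ideal_adjoin)

lemma foldl_adjoin_subset:
  assumes "is_ideal L" "I \<subseteq> L" "set as \<subseteq> L"
  shows "foldl adjoin I as \<subseteq> L"
  using assms(2,3)
proof (induction as arbitrary: I)
  case (Cons a as)
  have "adjoin I a \<subseteq> L"
    using Cons.prems is_idealD(3,5)[OF assms(1)] by (auto elim!: adjoinE)
  then show ?case
    using Cons by simp
qed simp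

text \<open>The snake lemma for multiplication by \<open>a\<close> on
  \<open>0 \<rightarrow> S/(I:f) \<rightarrow> S/I \<rightarrow> S/(I+fS) \<rightarrow> 0\<close>: this sequence stays exact modulo \<open>a\<close>.\<close>

lemma weakly_regular_colon:
  assumes "is_ideal I" "is_ideal I'" "f \<in> S" "set as \<subseteq> S"
    and "\<And>z. z \<in> S \<Longrightarrow> f * z \<in> I \<longleftrightarrow> z \<in> I'"
    and "weakly_regular I' as" "weakly_regular (adjoin I f) as"
  shows "weakly_regular I as"
  using assms
proof (induction as arbitrary: I I')
  case (Cons a as)
  note I = is_idealD[OF Cons.prems(1)] and I' = is_idealD[OF Cons.prems(2)]
  note colon = Cons.prems(5)
  have a: "a \<in> S" and f: "f \<in> S"
    using Cons.prems by auto
  have nzd': "z \<in> I'" if "z \<in> S" "a * z \<in> I'" for z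
    using that Cons.prems by auto
  have nzd'': "z \<in> adjoin I f" if "z \<in> S" "a * z \<in> adjoin I f" for z
    using that Cons.prems by auto
  have nzd: "z \<in> I" if z: "z \<in> S" "a * z \<in> I" for z
  proof -
    have "z \<in> adjoin I f"
      using nzd'' z subset_adjoin by blast
    then obtain y r where y: "y \<in> I" "r \<in> S" "z = y + f * r"
      by (rule adjoinE)
    have "a * z - a * y \<in> I"
      using y z I(4)[OF a] by (intro is_ideal_diff[OF Cons.prems(1)])
    then have "f * (a * r) \<in> I"
      by (simp add: y algebra_simps)
    then have "r \<in> I'"
      using colon mult_mem a y nzd' by metis
    then show "z \<in> I"
      using y colon I(3) by auto
  qed
  have "weakly_regular (adjoin I a) as"
  proof (rule Cons.IH)
    show "is_ideal (adjoin I a)" "is_ideal (adjoin I' a)" "f \<in> S" "set as \<subseteq> S"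
      using Cons.prems by (auto intro: is_ideal_adjoin)
    show "weakly_regular (adjoin I' a) as"
      using Cons.prems by simp
    have "adjoin (adjoin I a) f = adjoin (adjoin I f) a"
      by (auto simp: adjoin_def) (metis add.assoc add.commute)+
    then show "weakly_regular (adjoin (adjoin I a) f) as"
      using Cons.prems by simp
    fix z assume z: "z \<in> S"
    \<comment> \<open>Colon and reduction modulo \<open>a\<close> commute: (I + aS) : f = I' + aS.
      If f z = y + a r, then a r lies in I + fS, hence so does r, say r = y' + f s; then f (z - a s)
      = y + a y' lies in I.\<close>
    show "f * z \<in> adjoin I a \<longleftrightarrow> z \<in> adjoin I' a"
    proof
      assume "f * z \<in> adjoin I a"
      then obtain y r where y: "y \<in> I" "r \<in> S" "f * z = y + a * r"
        by (rule adjoinE)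
      have "- y + f * z \<in> adjoin I f"
        using y z by (intro adjoinI is_ideal_uminus[OF Cons.prems(1)])
      then have "r \<in> adjoin I f"
        using y nzd'' by simp
      then obtain y' s where s: "y' \<in> I" "s \<in> S" "r = y' + f * s"
        by (rule adjoinE)
      have "f * (z - a * s) = y + a * y'"
        using y s by (simp add: algebra_simps)
      also have "\<dots> \<in> I"
        using y s I(3) I(4)[OF a] by blast
      finally have "z - a * s \<in> I'"
        using colon z s a by (metis diff_mem mult_mem)
      then show "z \<in> adjoin I' a"
        using adjoinI[of "z - a * s" I' s a] s by simp
    next
      assume "z \<in> adjoin I' a"
      then obtain y r where y: "y \<in> I'" "r \<in> S" "z = y + a * r"
        by (rule adjoinE)
      then have "f * y + a * (f * r) \<in> adjoin I a"
        using colon I'(1) f by (intro adjoinI mult_mem) auto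
      then show "f * z \<in> adjoin I a"
        by (simp add: y algebra_simps)
    qed
  qed
  then show ?case
    using nzd by simp
qed simp

end

section \<open>Koszul cohomology\<close>

text \<open>The Koszul differential, or exterior multiplication by the 1-form \<open>w\<close>.  Cochains are functions on
  all lists of indices, not only on increasing ones: then prefixing an index is a homotopy.\<close>

fun koszul :: "(nat \<Rightarrow> 'a::comm_ring_1) \<Rightarrow> (nat list \<Rightarrow> 'a) \<Rightarrow> nat list \<Rightarrow> 'a" where
  "koszul w c [] = 0"
| "koszul w c (v # l) = w v * c l - koszul w (\<lambda>m. c (v # m)) l"

lemma koszul_cong:
  assumes "\<And>v. v \<in> set l \<Longrightarrow> w v = w' v"
    and "\<And>m. set m \<subseteq> set l \<Longrightarrow> Suc (length m) = length l \<Longrightarrow> c m = c' m"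
  shows "koszul w c l = koszul w' c' l"
  using assms
proof (induction l arbitrary: c c')
  case (Cons v l)
  have "koszul w (\<lambda>m. c (v # m)) l = koszul w' (\<lambda>m. c' (v # m)) l"
    using Cons.prems by (intro Cons.IH) (auto simp: subset_iff)
  moreover have "c l = c' l"
    using Cons.prems by auto
  ultimately show ?case
    using Cons.prems by simp
qed simp

lemma koszul_add: "koszul w (\<lambda>m. c m + c' m) l = koszul w c l + koszul w c' l"
  by (induction l arbitrary: c c') (simp_all add: algebra_simps)

lemma koszul_mult: "koszul w (\<lambda>m. r * c m) l = r * koszul w c l"
  by (induction l arbitrary: c) (simp_all add: algebra_simps)

lemma koszul_uminus: "koszul w (\<lambda>m. - c m) l = - koszul w c l"
  using koszul_mult[of w "- 1" c l] by simp

lemma koszul_diff: "koszul w (\<lambda>m. c m - c' m) l = koszul w c l - koszul w c' l"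
  using koszul_add[of w c "\<lambda>m. - c' m" l] by (simp add: koszul_uminus)

lemma koszul_zero: "koszul w (\<lambda>m. 0) l = 0"
  using koszul_mult[of w 0 "\<lambda>m. 0" l] by simp

lemma koszul_sum: "koszul w (\<lambda>m. \<Sum>i\<in>A. c i m) l = (\<Sum>i\<in>A. koszul w (c i) l)"
  by (induction A rule: infinite_finite_induct) (simp_all add: koszul_zero koszul_add)

lemma koszul_weight_zero: "koszul (\<lambda>v. 0) c l = 0"
  by (induction l arbitrary: c) simp_all

lemma koszul_weight_add: "koszul (\<lambda>v. w v + w' v) c l = koszul w c l + koszul w' c l"
  by (induction l arbitrary: c) (simp_all add: algebra_simps)

lemma koszul_weight_sum: "koszul (\<lambda>v. \<Sum>i\<in>A. w i v) c l = (\<Sum>i\<in>A. koszul (w i) c l)"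
  by (induction A rule: infinite_finite_induct) (simp_all add: koszul_weight_zero koszul_weight_add)

lemma koszul_koszul: "koszul w (koszul w c) l = 0"
proof (induction l arbitrary: c)
  case (Cons v l)
  show ?case
    using Cons[of "\<lambda>m. c (v # m)"] by (simp add: koszul_diff koszul_mult)
qed simp

lemma koszul_anticommute: "koszul w (koszul w' c) l = - koszul w' (koszul w c) l"
proof (induction l arbitrary: c)
  case (Cons v l)
  show ?case
    using Cons[of "\<lambda>m. c (v # m)"] by (simp add: koszul_diff koszul_mult)
qed simp

text \<open>On a list of the same length as \<open>ws\<close> this is the determinant with entries
  w_i(l_j), expanded along its first row; on lists of any other length it is 0.\<close>

definition wedge :: "(nat \<Rightarrow> 'a::comm_ring_1) list \<Rightarrow> nat list \<Rightarrow> 'a" where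
  "wedge ws = foldr koszul ws (\<lambda>l. if l = [] then 1 else 0)"

lemma wedge_simps [simp]:
  "wedge [] l = (if l = [] then 1 else 0)"
  "wedge (w # ws) = koszul w (wedge ws)"
  by (simp_all add: wedge_def)

lemma wedge_eq_0:
  assumes "w \<in> set ws" "\<And>v. v \<in> set l \<Longrightarrow> w v = 0"
  shows "wedge ws l = 0"
  using assms
proof (induction ws arbitrary: l)
  case (Cons w' ws)
  show ?case
  proof (cases "w = w'")
    case True
    have "koszul w' (wedge ws) l = koszul (\<lambda>v. 0) (wedge ws) l"
      using Cons.prems True by (intro koszul_cong) auto
    then show ?thesis
      by (simp add: koszul_weight_zero)
  next
    case False
    have "koszul w' (wedge ws) l = koszul w' (\<lambda>m. 0) l"
      using Cons False by (intro koszul_cong) (auto simp: subset_iff)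
    then show ?thesis
      by (simp add: koszul_zero)
  qed
qed simp

lemma koszul_wedge_eq_0:
  assumes "w \<in> set ws"
  shows "koszul w (wedge ws) l = 0"
  using assms
proof (induction ws arbitrary: l)
  case (Cons w' ws)
  show ?case
  proof (cases "w = w'")
    case True
    then show ?thesis
      by (simp add: koszul_koszul)
  next
    case False
    then have "koszul w (wedge ws) = (\<lambda>l. 0)"
      using Cons by auto
    then show ?thesis
      by (simp add: koszul_anticommute[of w w'] koszul_zero)
  qed
qed simp

text \<open>The coboundary is exterior multiplication by the constant 1-form 1. If the factors sum
  to 1 on the entries of \<open>l\<close>, it is there a sum of multiplications by factors already
  present, each of which gives 0. If a factor vanishes on these entries, the wedge product is itself
  0 on all sublists.\<close>

lemma wedge_cocycle:
  assumes "(\<exists>j\<in>set js. \<forall>v\<in>set l. \<alpha> j v = 0) \<or> (\<forall>v\<in>set l. (\<Sum>j\<in>set js. \<alpha> j v) = 1)"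
  shows "koszul (\<lambda>v. 1) (wedge (map \<alpha> js)) l = 0"
  using assms
proof
  assume "\<exists>j\<in>set js. \<forall>v\<in>set l. \<alpha> j v = 0"
  then obtain j where j: "j \<in> set js" "\<And>v. v \<in> set l \<Longrightarrow> \<alpha> j v = 0"
    by auto
  have "koszul (\<lambda>v. 1) (wedge (map \<alpha> js)) l = koszul (\<lambda>v. 1) (\<lambda>m. 0) l"
    using j by (intro koszul_cong wedge_eq_0[where w = "\<alpha> j"]) auto
  then show ?thesis
    by (simp add: koszul_zero)
next
  assume "\<forall>v\<in>set l. (\<Sum>j\<in>set js. \<alpha> j v) = 1"
  then have "koszul (\<lambda>v. 1) (wedge (map \<alpha> js)) l
      = koszul (\<lambda>v. \<Sum>j\<in>set js. \<alpha> j v) (wedge (map \<alpha> js)) l"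
    by (intro koszul_cong) auto
  also have "\<dots> = 0"
    by (simp add: koszul_weight_sum koszul_wedge_eq_0)
  finally show ?thesis .
qed

text \<open>Evaluation of a cochain on the cross-polytope \<open>\<Prod>\<^sub>i ([p+3i+1] - [p+3i+2])\<close>, \<open>i < k\<close>.\<close>

fun cross_eval :: "nat \<Rightarrow> nat \<Rightarrow> (nat list \<Rightarrow> 'a::comm_ring_1) \<Rightarrow> 'a" where
  "cross_eval p 0 c = c []"
| "cross_eval p (Suc k) c =
     cross_eval (p + 3) k (\<lambda>m. c (Suc p # m)) - cross_eval (p + 3) k (\<lambda>m. c ((p + 2) # m))"

definition sparse :: "nat set \<Rightarrow> bool" where
  "sparse A \<longleftrightarrow> (\<forall>i\<in>A. Suc i \<notin> A)"

text \<open>Each list that is evaluated takes one vertex from each pair {p+3i+1, p+3i+2}. The gap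
  p+3i+3 keeps different pairs non-adjacent, so only independent sets strictly between p and p+3k
  matter.\<close>

lemma cross_eval_cong:
  assumes "\<And>l. length l = k \<Longrightarrow> set l \<subseteq> {p<..<p + 3 * k} \<Longrightarrow> sparse (set l) \<Longrightarrow> c l = c' l"
  shows "cross_eval p k c = cross_eval p k c'"
  using assms
proof (induction k arbitrary: p c c')
  case 0
  then show ?case
    by (simp add: sparse_def)
next
  case (Suc k)
  have "cross_eval (p + 3) k (\<lambda>m. c (q # m)) = cross_eval (p + 3) k (\<lambda>m. c' (q # m))"
    if "q = Suc p \<or> q = p + 2" for q
  proof (intro Suc.IH Suc.prems)
    fix l assume l: "length l = k" "set l \<subseteq> {p + 3<..<p + 3 + 3 * k}" "sparse (set l)"
    show "length (q # l) = Suc k" "set (q # l) \<subseteq> {p<..<p + 3 * Suc k}" "sparse (set (q # l))"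
      using l that by (force simp: sparse_def)+
  qed
  then show ?case
    by simp
qed

lemma cross_eval_diff: "cross_eval p k (\<lambda>l. c l - c' l) = cross_eval p k c - cross_eval p k c'"
  by (induction k arbitrary: p c c') (simp_all add: algebra_simps)

lemma cross_eval_mult: "cross_eval p k (\<lambda>l. r * c l) = r * cross_eval p k c"
  by (induction k arbitrary: p c) (simp_all add: algebra_simps)

lemma cross_eval_zero: "cross_eval p k (\<lambda>l. 0) = 0"
  using cross_eval_mult[of p k 0 "\<lambda>l. 0"] by simp

text \<open>The cross-polytope is a cycle: in each factor [p+1] - [p+2] the two terms that drop the
  vertex cancel. Hence evaluation on it detects nontrivial classes.\<close>

lemma cross_eval_koszul: "cross_eval p k (koszul (\<lambda>v. 1) c) = 0"
  by (induction k arbitrary: p c) (simp_all add: cross_eval_diff)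

text \<open>The i-th form vanishes on all pairs after the i-th, so the determinants are triangular
  and the alternating sum factors pair by pair.\<close>

lemma cross_eval_wedge:
  assumes "length ws = k"
    and "\<And>i v. i < k \<Longrightarrow> p + 3 * i + 3 < v \<Longrightarrow> v < p + 3 * k \<Longrightarrow> (ws ! i) v = 0"
  shows "cross_eval p k (wedge ws)
    = (\<Prod>i<k. (ws ! i) (p + 3 * i + 1) - (ws ! i) (p + 3 * i + 2))"
  using assms
proof (induction k arbitrary: p ws)
  case (Suc k)
  then obtain w ws' where ws: "ws = w # ws'"
    by (cases ws) auto
  have *: "cross_eval (p + 3) k (\<lambda>m. koszul w (wedge ws') (q # m))
      = w q * cross_eval (p + 3) k (wedge ws')" for q
    unfolding cross_eval_mult[symmetric]
  proof (intro cross_eval_cong)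
    fix l assume l: "set l \<subseteq> {p + 3<..<p + 3 + 3 * k}"
    have "koszul w (\<lambda>m. wedge ws' (q # m)) l = koszul (\<lambda>v. 0) (\<lambda>m. wedge ws' (q # m)) l"
      using l Suc.prems(2)[of 0] ws by (intro koszul_cong) force+
    then show "koszul w (wedge ws') (q # l) = w q * wedge ws' l"
      by (simp add: koszul_weight_zero)
  qed
  have "cross_eval (p + 3) k (wedge ws')
      = (\<Prod>i<k. (ws' ! i) (p + 3 + 3 * i + 1) - (ws' ! i) (p + 3 + 3 * i + 2))"
  proof (intro Suc.IH)
    show "length ws' = k"
      using Suc.prems ws by simp
    show "(ws' ! i) v = 0" if "i < k" "p + 3 + 3 * i + 3 < v" "v < p + 3 + 3 * k" for i v
      using Suc.prems(2)[of "Suc i" v] that ws by simp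
  qed
  moreover have "cross_eval p (Suc k) (wedge ws) = (w (Suc p) - w (p + 2)) * cross_eval (p + 3) k (wedge ws')"
    by (simp add: ws * algebra_simps del: koszul.simps)
  moreover have "(\<Prod>i<Suc k. (ws ! i) (p + 3 * i + 1) - (ws ! i) (p + 3 * i + 2))
      = (w (Suc p) - w (p + 2)) *
        (\<Prod>i<k. (ws' ! i) (p + 3 + 3 * i + 1) - (ws' ! i) (p + 3 + 3 * i + 2))"
    by (simp add: prod.lessThan_Suc_shift ws ac_simps del: prod.lessThan_Suc)
  ultimately show ?case
    by simp
qed simp

text \<open>The reason is that the independence complex of a path on \<open>3k+1\<close> vertices is contractible.\<close>

lemma cross_eval_path_cocycle:
  assumes "\<And>l. length l = Suc k \<Longrightarrow> set l \<subseteq> {p..p + 3 * k} \<Longrightarrow> sparse (set l) \<Longrightarrow>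
      koszul (\<lambda>v. 1) c l = 0"
  shows "cross_eval p k c = 0"
  using assms
proof (induction k arbitrary: p c)
  case 0
  then show ?case
    using "0.prems"[of "[p]"] by (simp add: sparse_def)
next
  case (Suc k)
  let ?c = "\<lambda>q m. c (q # m)" and ?d = "koszul (\<lambda>v. 1)"
  \<comment> \<open>The cocycle condition on {p, p+2} joined with the remaining pairs replaces the
    vertex p+2 by p. The term retaining both vertices is a coboundary in \<open>m\<close> and
    evaluates to 0.\<close>
  have "cross_eval (p + 3) k (\<lambda>m. ?d c (p # (p + 2) # m)) = cross_eval (p + 3) k (\<lambda>m. 0)"
  proof (intro cross_eval_cong Suc.prems)
    fix l assume l: "length l = k" "set l \<subseteq> {p + 3<..<p + 3 + 3 * k}" "sparse (set l)"
    show "length (p # (p + 2) # l) = Suc (Suc k)" "set (p # (p + 2) # l) \<subseteq> {p..p + 3 * Suc k}"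
      "sparse (set (p # (p + 2) # l))"
      using l by (force simp: sparse_def)+
  qed
  then have "cross_eval (p + 3) k (?c (p + 2)) = cross_eval (p + 3) k (?c p)"
    by (simp add: cross_eval_diff cross_eval_koszul cross_eval_zero)
  \<comment> \<open>Neither p nor p+1 is adjacent to the path p+3, ..., p+3+3k. On that path the
    cochains obtained by prefixing p and p+1 both have coboundary \<open>c\<close>, so their
    difference is a cocycle there.\<close>
  moreover have "cross_eval (p + 3) k (\<lambda>m. ?c (Suc p) m - ?c p m) = 0"
  proof (intro Suc.IH)
    fix l assume l: "length l = Suc k" "set l \<subseteq> {p + 3..p + 3 + 3 * k}" "sparse (set l)"
    have "?d c (q # l) = 0" if "q = p \<or> q = Suc p" for q
    proof (intro Suc.prems)
      show "length (q # l) = Suc (Suc k)" "set (q # l) \<subseteq> {p..p + 3 * Suc k}" "sparse (set (q # l))"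
        using l that by (force simp: sparse_def)+
    qed
    from this[of p] this[of "Suc p"] show "?d (\<lambda>m. ?c (Suc p) m - ?c p m) l = 0"
      by (simp add: koszul_diff)
  qed
  ultimately show ?case
    by (simp add: cross_eval_diff)
qed

context comm_subring
begin

lemma is_ideal_carrier: "is_ideal S"
  by (auto simp: is_ideal_def intro: zero_mem add_mem mult_mem)

lemma koszul_mem:
  assumes "is_ideal I" "x ` V \<subseteq> S" "l \<in> lists V"
    and "\<And>m. m \<in> lists V \<Longrightarrow> Suc (length m) = length l \<Longrightarrow> c m \<in> I"
  shows "koszul x c l \<in> I"
  using assms(3,4)
proof (induction l arbitrary: c)
  case Nil
  then show ?case
    using is_idealD(2)[OF assms(1)] by simp
next
  case (Cons v l)
  then have "koszul x (\<lambda>m. c (v # m)) l \<in> I" "c l \<in> I" "x v \<in> S"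
    using assms(2) by auto
  then show ?case
    using is_idealD(4)[OF assms(1)] is_ideal_diff[OF assms(1)] by simp
qed

text \<open>Cocycles and coboundaries are taken modulo \<open>I\<close> on representatives in
  \<open>S\<close>. The conditions modulo \<open>I\<close> see \<open>c\<close> only on lists of
  length k and \<open>b\<close> only on lists of length k - 1, so cochains need not be
  homogeneous.\<close>

definition nonzero_cohomology :: "(nat \<Rightarrow> 'a) \<Rightarrow> nat set \<Rightarrow> 'a set \<Rightarrow> nat \<Rightarrow> bool" where
  "nonzero_cohomology x V I k \<longleftrightarrow>
    (\<exists>c. (\<forall>l\<in>lists V. c l \<in> S) \<and> (\<forall>l\<in>lists V. length l = Suc k \<longrightarrow> koszul x c l \<in> I) \<and>
      (\<forall>b. (\<forall>l\<in>lists V. b l \<in> S) \<longrightarrow> (\<exists>l\<in>lists V. length l = k \<and> c l - koszul x b l \<notin> I)))"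

text \<open>A class of degree 0 is a socle element \<open>c []\<close> of S/I: it is nonzero and
  killed by every \<open>x v\<close>, hence by \<open>a\<close>.\<close>

lemma nonzero_cohomology_0:
  assumes "nonzero_cohomology x V I 0" "is_ideal I" "x ` V \<subseteq> S"
    and a: "a = (\<Sum>v\<in>V. x v * r v)" "\<forall>v\<in>V. r v \<in> S"
  shows "\<exists>z\<in>S. a * z \<in> I \<and> z \<notin> I"
proof -
  from assms(1) obtain c where c: "\<And>l. l \<in> lists V \<Longrightarrow> c l \<in> S"
      "\<And>l. l \<in> lists V \<Longrightarrow> length l = Suc 0 \<Longrightarrow> koszul x c l \<in> I"
    and c': "\<And>b. \<forall>l\<in>lists V. b l \<in> S \<Longrightarrow> \<exists>l\<in>lists V. length l = 0 \<and> c l - koszul x b l \<notin> I"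
    unfolding nonzero_cohomology_def by blast
  have "x v * c [] \<in> I" if "v \<in> V" for v
    using c(2)[of "[v]"] that by simp
  then have "(\<Sum>v\<in>V. r v * (x v * c [])) \<in> I"
    using a(2) is_idealD(4)[OF assms(2)] by (intro is_ideal_sum[OF assms(2)]) auto
  then have "a * c [] \<in> I"
    by (simp add: a sum_distrib_left sum_distrib_right algebra_simps)
  moreover have "c [] \<notin> I" "c [] \<in> S"
    using c(1)[of "[]"] c'[of "\<lambda>l. 0"] zero_mem by auto
  ultimately show ?thesis
    by blast
qed

text \<open>Multiplication by \<open>a = \<Sum>\<^sub>v x\<^sub>v r\<^sub>v\<close> on cochains is null-homotopic, via
  \<open>c \<mapsto> (l \<mapsto> \<Sum>\<^sub>v r\<^sub>v c (v l))\<close>.  So for a cocycle \<open>c\<close> the homotopy of \<open>c\<close> is a cocycle modulo \<open>a\<close>,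
  whose image under the connecting homomorphism is the class of \<open>c\<close>.\<close>

lemma nonzero_cohomology_adjoin:
  assumes "nonzero_cohomology x V I (Suc k)" "is_ideal I" "x ` V \<subseteq> S"
    and a: "a = (\<Sum>v\<in>V. x v * r v)" "\<forall>v\<in>V. r v \<in> S"
    and nzd: "\<forall>z\<in>S. a * z \<in> I \<longrightarrow> z \<in> I"
  shows "nonzero_cohomology x V (adjoin I a) k"
proof -
  from assms(1) obtain c where c: "\<And>l. l \<in> lists V \<Longrightarrow> c l \<in> S"
      "\<And>l. l \<in> lists V \<Longrightarrow> length l = Suc (Suc k) \<Longrightarrow> koszul x c l \<in> I"
    and c': "\<And>b. \<forall>l\<in>lists V. b l \<in> S \<Longrightarrow>
      \<exists>l\<in>lists V. length l = Suc k \<and> c l - koszul x b l \<notin> I"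
    unfolding nonzero_cohomology_def by blast
  define h where "h l = (\<Sum>v\<in>V. r v * c (v # l))" for l
  have h: "h l \<in> S" if "l \<in> lists V" for l
    unfolding h_def using that c(1) a(2) by (intro sum_mem mult_mem) auto
  have dh: "a * c l - koszul x h l \<in> I" if "l \<in> lists V" "length l = Suc k" for l
  proof -
    have "koszul x h l = (\<Sum>v\<in>V. r v * koszul x (\<lambda>m. c (v # m)) l)"
      by (simp add: h_def[abs_def] koszul_sum koszul_mult)
    also have "\<dots> = (\<Sum>v\<in>V. r v * (x v * c l - koszul x c (v # l)))"
      by simp
    also have "\<dots> = a * c l - (\<Sum>v\<in>V. r v * koszul x c (v # l))"
      by (simp add: a sum_distrib_left sum_distrib_right sum_subtractf algebra_simps
        del: koszul.simps)
    finally have "a * c l - koszul x h l = (\<Sum>v\<in>V. r v * koszul x c (v # l))"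
      by simp
    also have "\<dots> \<in> I"
      using that a(2) c(2) is_idealD(4)[OF assms(2)]
      by (intro is_ideal_sum[OF assms(2)]) (auto simp del: koszul.simps)
    finally show ?thesis .
  qed
  have "koszul x h l \<in> adjoin I a" if l: "l \<in> lists V" "length l = Suc k" for l
    using adjoinI[OF is_ideal_uminus[OF assms(2) dh[OF l]] c(1)[OF l(1)], of a] by simp
  moreover have "\<exists>l\<in>lists V. length l = k \<and> h l - koszul x b l \<notin> adjoin I a"
    if b: "\<And>l. l \<in> lists V \<Longrightarrow> b l \<in> S" for b
  proof (rule ccontr)
    assume not: "\<not> ?thesis"
    have "\<exists>g\<in>S. h l - koszul x b l - a * g \<in> I" if "l \<in> {l \<in> lists V. length l = k}" for l
    proof -
      have "h l - koszul x b l \<in> adjoin I a"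
        using not that by blast
      then obtain y g where "y \<in> I" "g \<in> S" "h l - koszul x b l = y + a * g"
        by (rule adjoinE)
      then show ?thesis
        by (intro bexI[of _ g]) simp_all
    qed
    then have "\<forall>l\<in>{l \<in> lists V. length l = k}. \<exists>g. g \<in> S \<and> h l - koszul x b l - a * g \<in> I"
      by blast
    from bchoice[OF this] obtain g where g: "\<And>l. l \<in> lists V \<Longrightarrow> length l = k \<Longrightarrow>
        g l \<in> S \<and> h l - koszul x b l - a * g l \<in> I"
      by blast
    \<comment> \<open>A cochain must take values in \<open>S\<close> on all lists, but
      \<open>g\<close> is controlled only in length k; elsewhere it is replaced by 0.\<close>
    define g' where "g' l = (if length l = k then g l else 0)" for l
    have g': "g' l \<in> S" if "l \<in> lists V" for l
      using g that by (auto simp: g'_def zero_mem)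
    have "c l - koszul x g' l \<in> I" if l: "l \<in> lists V" "length l = Suc k" for l
    proof (rule nzd[rule_format])
      show "c l - koszul x g' l \<in> S"
        using l g' c(1) assms(3)
        by (intro diff_mem koszul_mem[OF is_ideal_carrier]) auto
      \<comment> \<open>Applying the differential to h - db - a g' removes b and leaves dh - a dg'
        in I. Together with a c - dh in I this gives a (c - dg') in I, and \<open>a\<close> can be
        cancelled.\<close>
      have "koszul x (\<lambda>m. h m - koszul x b m - a * g' m) l \<in> I"
        using l g by (intro koszul_mem[OF assms(2,3)]) (auto simp: g'_def)
      then have "koszul x h l - a * koszul x g' l \<in> I"
        by (simp add: koszul_diff koszul_mult koszul_koszul)
      then have "(a * c l - koszul x h l) + (koszul x h l - a * koszul x g' l) \<in> I"
        using dh[OF l] is_idealD(3)[OF assms(2)] by blast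
      then show "a * (c l - koszul x g' l) \<in> I"
        by (simp add: algebra_simps)
    qed
    then show False
      using c'[of g'] g' by blast
  qed
  ultimately show ?thesis
    unfolding nonzero_cohomology_def
    by (intro exI[of _ h] conjI ballI allI impI) (simp_all add: h)
qed

theorem weakly_regular_length_le:
  assumes "nonzero_cohomology x V I k" "is_ideal I" "x ` V \<subseteq> S" "weakly_regular I as"
    and "\<And>a. a \<in> set as \<Longrightarrow> \<exists>r. a = (\<Sum>v\<in>V. x v * r v) \<and> (\<forall>v\<in>V. r v \<in> S)"
  shows "length as \<le> k"
  using assms
proof (induction as arbitrary: I k)
  case (Cons a as)
  from Cons.prems(5) obtain r where r: "a = (\<Sum>v\<in>V. x v * r v)" "\<forall>v\<in>V. r v \<in> S"
    by fastforce
  have nzd: "\<forall>z\<in>S. a * z \<in> I \<longrightarrow> z \<in> I"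
    using Cons.prems(4) by simp
  have "k \<noteq> 0"
    using nonzero_cohomology_0[of x V I, OF _ Cons.prems(2,3) r] Cons.prems(1) nzd by metis
  then obtain k' where k: "k = Suc k'"
    using not0_implies_Suc by blast
  have "a \<in> S"
    unfolding r(1) using Cons.prems(3) r(2) by (intro sum_mem mult_mem) auto
  then have "length as \<le> k'"
    using Cons nonzero_cohomology_adjoin[OF _ Cons.prems(2,3) r nzd] k
    by (intro Cons.IH[of "adjoin I a"]) (auto intro: is_ideal_adjoin)
  then show ?case
    by (simp add: k)
qed simp

end

section \<open>Quotient modules\<close>

lemma quot_module_simps:
  "carrier (quot_module M N) = (\<lambda>x. N +>\<^bsub>M\<^esub> x) ` carrier M"
  "\<zero>\<^bsub>quot_module M N\<^esub> = N"
  "r \<odot>\<^bsub>quot_module M N\<^esub> X = (\<Union>x\<in>X. N +>\<^bsub>M\<^esub> (r \<odot>\<^bsub>M\<^esub> x))"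
  by (auto simp: quot_module_def ring.extend_def module.fields_def FactRing_def A_RCOSETS_def
      RCOSETS_def a_r_coset_def)

context comm_subring
begin

text \<open>The bridge between the type-class operations used in the proof and the records in which
  depth is defined.\<close>

definition subring_record :: "'a ring" where
  "subring_record = \<lparr>carrier = S, mult = (*), one = 1, zero = 0, add = (+)\<rparr>"

lemma cring_subring_record: "cring subring_record"
proof (intro cringI abelian_groupI comm_monoidI)
  show "\<exists>y\<in>carrier subring_record. y \<oplus>\<^bsub>subring_record\<^esub> a = \<zero>\<^bsub>subring_record\<^esub>"
    if "a \<in> carrier subring_record" for a
    using that uminus_mem by (intro bexI[of _ "- a"]) (simp_all add: subring_record_def)
qed (auto simp: subring_record_def algebra_simps intro: zero_mem one_mem add_mem mult_mem)

lemma genideal_subring_record_minimal: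
  assumes "is_ideal I" "A \<subseteq> I"
  shows "Idl\<^bsub>subring_record\<^esub> A \<subseteq> I"
proof (rule ring.genideal_minimal)
  interpret cring subring_record
    by (rule cring_subring_record)
  show "ring subring_record"
    by (rule ring_axioms)
  show "ideal I subring_record"
  proof (rule idealI)
    show "ring subring_record"
      by (rule ring_axioms)
    show "subgroup I (add_monoid subring_record)"
    proof (rule add.subgroupI)
      show "\<ominus>\<^bsub>subring_record\<^esub> a \<in> I" if "a \<in> I" for a
      proof -
        have "\<ominus>\<^bsub>subring_record\<^esub> a = - a"
          using is_idealD(1)[OF assms(1) that]
          by (intro minus_equality) (auto simp: subring_record_def uminus_mem)
        then show ?thesis
          using is_ideal_uminus[OF assms(1) that] by simp
      qed
    qed (use assms(1) in \<open>auto simp: subring_record_def is_ideal_def\<close>)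
  qed (use is_idealD[OF assms(1)] in \<open>auto simp: subring_record_def\<close>)
qed (fact assms)

lemma is_ideal_genideal_subring_record:
  assumes "A \<subseteq> S"
  shows "is_ideal (Idl\<^bsub>subring_record\<^esub> A)"
proof -
  interpret cring subring_record
    by (rule cring_subring_record)
  interpret ideal "Idl\<^bsub>subring_record\<^esub> A" subring_record
    using assms by (intro genideal_ideal) (simp add: subring_record_def)
  show ?thesis
    using a_subset a_closed I_l_closed additive_subgroup.zero_closed[OF additive_subgroup_axioms]
    by (auto simp: is_ideal_def subring_record_def)
qed

definition coset :: "'a set \<Rightarrow> 'a \<Rightarrow> 'a set" where
  "coset I z = (\<lambda>y. y + z) ` I"

lemma coset_eq_iff:
  assumes "is_ideal I"
  shows "coset I a = coset I b \<longleftrightarrow> a - b \<in> I"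
proof
  assume "coset I a = coset I b"
  moreover have "0 + a \<in> coset I a"
    unfolding coset_def using is_idealD(2)[OF assms] by blast
  ultimately show "a - b \<in> I"
    by (auto simp: coset_def)
next
  assume ab: "a - b \<in> I"
  have "coset I a \<subseteq> coset I b" if "a - b \<in> I" for a b
  proof
    fix z assume "z \<in> coset I a"
    then obtain y where y: "y \<in> I" "z = y + a"
      by (auto simp: coset_def)
    have "z = (y + (a - b)) + b"
      using y by simp
    then show "z \<in> coset I b"
      unfolding coset_def using is_idealD(3)[OF assms y(1) that] by blast
  qed
  then show "coset I a = coset I b"
    using ab is_ideal_uminus[OF assms ab] by auto
qed

lemma coset_eq_ideal_iff: "is_ideal I \<Longrightarrow> coset I a = I \<longleftrightarrow> a \<in> I"
  using coset_eq_iff[of I a 0] by (simp add: coset_def)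

abbreviation quotient :: "'a set \<Rightarrow> ('a, 'a set) module" where
  "quotient I \<equiv> quot_module (regular_module subring_record) I"

lemma quotient_simps:
  assumes "is_ideal I"
  shows "carrier (quotient I) = coset I ` S"
    and "\<zero>\<^bsub>quotient I\<^esub> = I"
    and "coset I a \<oplus>\<^bsub>quotient I\<^esub> coset I b = coset I (a + b)"
    and "r \<in> S \<Longrightarrow> r \<odot>\<^bsub>quotient I\<^esub> coset I a = coset I (r * a)"
proof -
  note defs = quot_module_def ring.extend_def module.fields_def regular_module_def
    subring_record_def FactRing_def A_RCOSETS_def RCOSETS_def r_coset_def a_r_coset_def
    set_add_def set_mult_def
  show "carrier (quotient I) = coset I ` S" "\<zero>\<^bsub>quotient I\<^esub> = I"
    by (auto simp: defs coset_def)
  have add: "coset I a \<oplus>\<^bsub>quotient I\<^esub> coset I b = {u + v | u v. u \<in> coset I a \<and> v \<in> coset I b}"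
    by (auto simp: defs)
  show "coset I a \<oplus>\<^bsub>quotient I\<^esub> coset I b = coset I (a + b)"
  proof (intro subset_antisym subsetI)
    fix z assume "z \<in> coset I a \<oplus>\<^bsub>quotient I\<^esub> coset I b"
    then obtain y y' where y: "y \<in> I" "y' \<in> I" "z = (y + a) + (y' + b)"
      unfolding add unfolding coset_def by blast
    then have "z = (y + y') + (a + b)"
      by simp
    then show "z \<in> coset I (a + b)"
      unfolding coset_def using is_idealD(3)[OF assms y(1,2)] by blast
  next
    fix z assume "z \<in> coset I (a + b)"
    then obtain y where y: "y \<in> I" "z = (y + a) + (0 + b)"
      by (auto simp: coset_def)
    then show "z \<in> coset I a \<oplus>\<^bsub>quotient I\<^esub> coset I b"
      unfolding add unfolding coset_def using is_idealD(2)[OF assms] by blast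
  qed
  assume r: "r \<in> S"
  have "r \<odot>\<^bsub>quotient I\<^esub> coset I a = (\<Union>y\<in>I. coset I (r * (y + a)))"
    by (auto simp: defs coset_def)
  also have "\<dots> = (\<Union>y\<in>I. coset I (r * a))"
    using is_idealD(4)[OF assms r] by (intro SUP_cong refl) (simp add: coset_eq_iff[OF assms] algebra_simps)
  also have "\<dots> = coset I (r * a)"
    using is_idealD(2)[OF assms] by auto
  finally show "r \<odot>\<^bsub>quotient I\<^esub> coset I a = coset I (r * a)" .
qed

lemma abelian_monoid_quotient:
  assumes "is_ideal I"
  shows "abelian_monoid (quotient I)"
proof (rule abelian_monoidI)
  have "\<zero>\<^bsub>quotient I\<^esub> = coset I 0"
    by (simp add: quotient_simps(2)[OF assms] coset_def)
  then show "\<zero>\<^bsub>quotient I\<^esub> \<in> carrier (quotient I)"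
    "\<And>x. x \<in> carrier (quotient I) \<Longrightarrow> \<zero>\<^bsub>quotient I\<^esub> \<oplus>\<^bsub>quotient I\<^esub> x = x"
    by (auto simp: quotient_simps(1,3)[OF assms] zero_mem)
qed (auto simp: quotient_simps(1,3)[OF assms] add_mem ac_simps)

lemma finsum_quotient:
  assumes "is_ideal I" "finite A" "\<And>i. i \<in> A \<Longrightarrow> f i \<in> S"
  shows "(\<Oplus>\<^bsub>quotient I\<^esub>i\<in>A. coset I (f i)) = coset I (sum f A)"
proof -
  interpret abelian_monoid "quotient I"
    by (rule abelian_monoid_quotient[OF assms(1)])
  show ?thesis
    using assms(2,3)
    by (induction A) (auto simp: quotient_simps[OF assms(1)] coset_def[of I 0])
qed

lemma foldl_adjoin_eq:
  assumes "is_ideal I" "set as \<subseteq> S"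
  shows "foldl adjoin I as =
    {y + (\<Sum>i<length as. as ! i * f i) | y f. y \<in> I \<and> f \<in> {..<length as} \<rightarrow> S}"
  using assms
proof (induction as rule: rev_induct)
  case (snoc a as)
  have IH: "foldl adjoin I as =
      {y + (\<Sum>i<length as. as ! i * f i) | y f. y \<in> I \<and> f \<in> {..<length as} \<rightarrow> S}"
    using snoc by simp
  have nth: "(\<Sum>i<length as. (as @ [a]) ! i * f i) = (\<Sum>i<length as. as ! i * f i)" for f
    by (intro sum.cong) (auto simp: nth_append)
  show ?case
  proof (intro subset_antisym subsetI)
    fix z assume "z \<in> foldl adjoin I (as @ [a])"
    then obtain y f r where *: "y \<in> I" "f \<in> {..<length as} \<rightarrow> S" "r \<in> S"
      "z = y + (\<Sum>i<length as. as ! i * f i) + a * r"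
      by (auto simp: IH elim!: adjoinE)
    have "(\<Sum>i<length as. as ! i * (f(length as := r)) i) = (\<Sum>i<length as. as ! i * f i)"
      by (intro sum.cong) auto
    then have "z = y + (\<Sum>i<length (as @ [a]). (as @ [a]) ! i * (f(length as := r)) i)"
      using * by (simp add: nth add.assoc)
    moreover have "f(length as := r) \<in> {..<length (as @ [a])} \<rightarrow> S"
      using * by (auto simp: less_Suc_eq)
    ultimately show "z \<in> {y + (\<Sum>i<length (as @ [a]). (as @ [a]) ! i * f i) | y f.
        y \<in> I \<and> f \<in> {..<length (as @ [a])} \<rightarrow> S}"
      using *(1) by blast
  next
    fix z assume "z \<in> {y + (\<Sum>i<length (as @ [a]). (as @ [a]) ! i * f i) | y f.
        y \<in> I \<and> f \<in> {..<length (as @ [a])} \<rightarrow> S}"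
    then obtain y f where *: "y \<in> I" "f \<in> {..<length (as @ [a])} \<rightarrow> S"
      "z = y + (\<Sum>i<length (as @ [a]). (as @ [a]) ! i * f i)"
      by blast
    have f: "f \<in> {..<length as} \<rightarrow> S" "f (length as) \<in> S"
      using *(2) by auto
    then have "y + (\<Sum>i<length as. as ! i * f i) \<in> foldl adjoin I as"
      unfolding IH using *(1) by blast
    then have "y + (\<Sum>i<length as. as ! i * f i) + a * f (length as) \<in> adjoin (foldl adjoin I as) a"
      using f(2) by (rule adjoinI)
    then show "z \<in> foldl adjoin I (as @ [a])"
      by (simp add: *(3) nth add.assoc)
  qed
qed simp

lemma list_smult_quotient:
  assumes "is_ideal I" "set as \<subseteq> S"
  shows "list_smult (quotient I) as = coset I ` foldl adjoin I as"
proof -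
  have smult: "(\<Oplus>\<^bsub>quotient I\<^esub>i\<in>{..<length as}. as ! i \<odot>\<^bsub>quotient I\<^esub> f i)
      = coset I (\<Sum>i<length as. as ! i * g i)"
    if "\<And>i. i < length as \<Longrightarrow> g i \<in> S \<and> f i = coset I (g i)" for f g
  proof -
    interpret abelian_monoid "quotient I"
      by (rule abelian_monoid_quotient[OF assms(1)])
    have as: "as ! i \<in> S" if "i < length as" for i
      using assms(2) that by auto
    have "(\<Oplus>\<^bsub>quotient I\<^esub>i\<in>{..<length as}. as ! i \<odot>\<^bsub>quotient I\<^esub> f i)
        = (\<Oplus>\<^bsub>quotient I\<^esub>i\<in>{..<length as}. coset I (as ! i * g i))"
      using that as
      by (intro finsum_cong') (auto simp: quotient_simps[OF assms(1)] intro!: imageI mult_mem)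
    also have "\<dots> = coset I (\<Sum>i<length as. as ! i * g i)"
      using that as by (intro finsum_quotient[OF assms(1)]) (auto intro: mult_mem)
    finally show ?thesis .
  qed
  show ?thesis
  proof (intro subset_antisym subsetI)
    fix X assume "X \<in> list_smult (quotient I) as"
    then obtain f where f: "f \<in> {..<length as} \<rightarrow> coset I ` S"
      "X = (\<Oplus>\<^bsub>quotient I\<^esub>i\<in>{..<length as}. as ! i \<odot>\<^bsub>quotient I\<^esub> f i)"
      by (auto simp: list_smult_def quotient_simps(1)[OF assms(1)])
    then have "\<forall>i\<in>{..<length as}. \<exists>z. z \<in> S \<and> f i = coset I z"
      by (auto simp: Pi_iff image_iff)
    from bchoice[OF this] obtain g where g: "\<And>i. i < length as \<Longrightarrow> g i \<in> S \<and> f i = coset I (g i)"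
      by auto
    have "0 + (\<Sum>i<length as. as ! i * g i) \<in> foldl adjoin I as"
      unfolding foldl_adjoin_eq[OF assms] using g is_idealD(2)[OF assms(1)] by blast
    then show "X \<in> coset I ` foldl adjoin I as"
      using f(2) smult[OF g] by simp
  next
    fix X assume "X \<in> coset I ` foldl adjoin I as"
    then obtain y g where g: "y \<in> I" "g \<in> {..<length as} \<rightarrow> S"
      "X = coset I (y + (\<Sum>i<length as. as ! i * g i))"
      by (auto simp: foldl_adjoin_eq[OF assms])
    then have "X = (\<Oplus>\<^bsub>quotient I\<^esub>i\<in>{..<length as}. as ! i \<odot>\<^bsub>quotient I\<^esub> coset I (g i))"
      by (subst smult[of g]) (auto simp: coset_eq_iff[OF assms(1)])
    then show "X \<in> list_smult (quotient I) as"
      using g(2) by (auto simp: list_smult_def quotient_simps(1)[OF assms(1)] intro!: exI[of _ "\<lambda>i. coset I (g i)"])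
  qed
qed

text \<open>The third isomorphism theorem in concrete form. An element of (S/I)/(L/I) is a set of
  cosets of \<open>I\<close>; the class of \<open>z\<close> is the set of cosets of \<open>I\<close>
  that make up z + L.\<close>

lemma quotient_quotient:
  assumes "is_ideal I" "is_ideal L" "I \<subseteq> L"
  defines "N \<equiv> coset I ` L"
  defines "Q \<equiv> quot_module (quotient I) N"
  shows "carrier Q = (\<lambda>z. coset I ` coset L z) ` S"
    and "\<zero>\<^bsub>Q\<^esub> = N"
    and "a \<in> S \<Longrightarrow> a \<odot>\<^bsub>Q\<^esub> (coset I ` coset L z) = coset I ` coset L (a * z)"
    and "coset I ` coset L z = N \<longleftrightarrow> z \<in> L"
proof -
  have rcoset: "N +>\<^bsub>quotient I\<^esub> coset I z = coset I ` coset L z" for z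
    by (auto simp: a_r_coset_def r_coset_def N_def coset_def[of L] quotient_simps(3)[OF assms(1)])
  show "carrier Q = (\<lambda>z. coset I ` coset L z) ` S"
    by (simp add: Q_def quot_module_simps(1)[of "quotient I"] quotient_simps(1)[OF assms(1)]
        image_image rcoset)
  show "\<zero>\<^bsub>Q\<^esub> = N"
    by (simp add: Q_def quot_module_simps(2))
  show "coset I ` coset L z = N \<longleftrightarrow> z \<in> L"
  proof
    assume "coset I ` coset L z = N"
    moreover have "0 + z \<in> coset L z"
      unfolding coset_def using is_idealD(2)[OF assms(2)] by blast
    ultimately have "coset I z \<in> coset I ` L"
      by (auto simp: N_def)
    then obtain y where y: "y \<in> L" "z - y \<in> I"
      by (auto simp: coset_eq_iff[OF assms(1)])
    then have "(z - y) + y \<in> L"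
      using assms(3) by (intro is_idealD(3)[OF assms(2)]) auto
    then show "z \<in> L"
      by simp
  next
    assume "z \<in> L"
    then have "coset L z = L"
      using coset_eq_ideal_iff[OF assms(2)] by blast
    then show "coset I ` coset L z = N"
      by (simp add: N_def)
  qed
  assume a: "a \<in> S"
  have "a \<odot>\<^bsub>Q\<^esub> (coset I ` coset L z)
      = (\<Union>y\<in>L. N +>\<^bsub>quotient I\<^esub> coset I (a * (y + z)))"
    by (simp add: Q_def quot_module_simps(3)[of "quotient I"] coset_def[of L]
        quotient_simps(4)[OF assms(1) a])
  also have "\<dots> = (\<Union>y\<in>L. coset I ` coset L (a * z))"
  proof (intro SUP_cong refl)
    fix y assume "y \<in> L"
    then have "coset L (a * (y + z)) = coset L (a * z)"
      using is_idealD(4)[OF assms(2) a] by (simp add: coset_eq_iff[OF assms(2)] distrib_left)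
    then show "N +>\<^bsub>quotient I\<^esub> coset I (a * (y + z)) = coset I ` coset L (a * z)"
      by (simp add: rcoset)
  qed
  also have "\<dots> = coset I ` coset L (a * z)"
    using is_idealD(2)[OF assms(2)] by auto
  finally show "a \<odot>\<^bsub>Q\<^esub> (coset I ` coset L z) = coset I ` coset L (a * z)" .
qed

lemma subset_foldl_adjoin: "I \<subseteq> foldl adjoin I as"
proof (induction as arbitrary: I)
  case (Cons a as)
  then show ?case
    using subset_adjoin[of I a] Cons.IH[of "adjoin I a"] by auto
qed simp

text \<open>The submodule (a_1, ..., a_k)(S/I) is the image of I + (a_1, ..., a_k), so every
  iterated quotient is S modulo an ideal and the definition becomes a statement about ideals. A
  quotient of S is nonzero exactly if 1 is not in the ideal.\<close>

theorem regular_sequence_quotient_iff: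
  assumes "is_ideal I"
  shows "regular_sequence subring_record (quotient I) as \<longleftrightarrow>
    set as \<subseteq> S \<and> weakly_regular I as \<and> 1 \<notin> foldl adjoin I as"
proof (cases "set as \<subseteq> S")
  case True
  have "nonzerodivisor_on a (quot_module (quotient I) (list_smult (quotient I) bs)) \<longleftrightarrow>
      (\<forall>z\<in>S. a * z \<in> foldl adjoin I bs \<longrightarrow> z \<in> foldl adjoin I bs)"
    if "set bs \<subseteq> S" "a \<in> S" for a bs
  proof -
    note Q = quotient_quotient[OF assms is_ideal_foldl_adjoin[OF assms that(1)] subset_foldl_adjoin]
    show ?thesis
      unfolding nonzerodivisor_on_def list_smult_quotient[OF assms that(1)]
      using that(2) by (simp add: Q mult_mem)
  qed
  moreover have "set (take i as) \<subseteq> S" for i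
    using True set_take_subset by fast
  moreover have "as ! i \<in> S" if "i < length as" for i
    using True that by auto
  moreover have "carrier (quot_module (quotient I) (list_smult (quotient I) as)) \<noteq>
      {\<zero>\<^bsub>quot_module (quotient I) (list_smult (quotient I) as)\<^esub>} \<longleftrightarrow> 1 \<notin> foldl adjoin I as"
  proof -
    note L = is_ideal_foldl_adjoin[OF assms True]
    note Q = quotient_quotient[OF assms L subset_foldl_adjoin]
    have image: "f ` S \<noteq> {N} \<longleftrightarrow> (\<exists>z\<in>S. f z \<noteq> N)" for f :: "'a \<Rightarrow> 'a set set" and N
      using zero_mem by auto
    have "carrier (quot_module (quotient I) (list_smult (quotient I) as)) \<noteq>
      {\<zero>\<^bsub>quot_module (quotient I) (list_smult (quotient I) as)\<^esub>} \<longleftrightarrow>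
      (\<exists>z\<in>S. z \<notin> foldl adjoin I as)"
      unfolding list_smult_quotient[OF assms True] Q(1,2) image by (simp only: Q(4))
    also have "\<dots> \<longleftrightarrow> 1 \<notin> foldl adjoin I as"
      using is_idealD(4)[OF L, of _ 1] one_mem by auto
    finally show ?thesis .
  qed
  ultimately show ?thesis
    using True by (simp add: regular_sequence_def weakly_regular_iff_nth subring_record_def)
next
  case False
  then show ?thesis
    by (simp add: regular_sequence_def subring_record_def)
qed

end

section \<open>Polynomials and squarefree monomial ideals\<close>

abbreviation mconst :: "'k::field \<Rightarrow> 'k mpolynomial" where
  "mconst c \<equiv> Poly_Mapping.single 0 c"

definition polys :: "nat \<Rightarrow> 'k::field mpolynomial set" where
  "polys n = {p. \<forall>m \<in> Poly_Mapping.keys p. Poly_Mapping.keys m \<subseteq> {1..n}}"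

interpretation mpoly: comm_subring "polys n" for n
proof
  show "1 \<in> polys n"
    by (simp add: polys_def)
next
  fix p q :: "'k::field mpolynomial"
  assume pq: "p \<in> polys n" "q \<in> polys n"
  then show "p + q \<in> polys n"
    using keys_add[of p q] by (force simp: polys_def)
  show "p * q \<in> polys n"
    unfolding polys_def
  proof (intro CollectI ballI)
    fix m assume "m \<in> Poly_Mapping.keys (p * q)"
    then obtain a b where "a \<in> Poly_Mapping.keys p" "b \<in> Poly_Mapping.keys q" "m = a + b"
      using keys_mult[of p q] by blast
    then show "Poly_Mapping.keys m \<subseteq> {1..n}"
      using pq keys_add[of a b] by (force simp: polys_def)
  qed
next
  fix p :: "'k::field mpolynomial"
  assume "p \<in> polys n"
  then show "- p \<in> polys n"
    by (simp add: polys_def in_keys_iff)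
qed

lemma keys_add_nat:
  "Poly_Mapping.keys (a + b) = Poly_Mapping.keys a \<union> Poly_Mapping.keys (b :: nat \<Rightarrow>\<^sub>0 nat)"
  by (auto simp: in_keys_iff lookup_add)

lemma sum_single_lookup: "(\<Sum>m\<in>Poly_Mapping.keys p. Poly_Mapping.single m (poly_mapping.lookup p m)) = p"
proof (rule poly_mapping_eqI)
  fix k
  show "poly_mapping.lookup (\<Sum>m\<in>Poly_Mapping.keys p. Poly_Mapping.single m (poly_mapping.lookup p m)) k = poly_mapping.lookup p k"
    by (cases "k \<in> Poly_Mapping.keys p")
      (auto simp: lookup_sum lookup_single when_def in_keys_iff)
qed

lemma lookup_single_mult:
  fixes p :: "'k::field mpolynomial"
  shows "poly_mapping.lookup (Poly_Mapping.single a c * p) (a + m) = c * poly_mapping.lookup p m"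
proof -
  have "Poly_Mapping.single a c * p
      = (\<Sum>m'\<in>Poly_Mapping.keys p. Poly_Mapping.single (a + m') (c * poly_mapping.lookup p m'))"
    by (subst (1) sum_single_lookup[symmetric]) (simp add: sum_distrib_left mult_single)
  then show ?thesis
    by (cases "m \<in> Poly_Mapping.keys p")
      (auto simp: lookup_sum lookup_single when_def in_keys_iff)
qed

lemma keys_single_mult:
  fixes p :: "'k::field mpolynomial"
  assumes "c \<noteq> 0"
  shows "Poly_Mapping.keys (Poly_Mapping.single a c * p) = (+) a ` Poly_Mapping.keys p"
proof (intro subset_antisym subsetI)
  show "m \<in> (+) a ` Poly_Mapping.keys p"
    if "m \<in> Poly_Mapping.keys (Poly_Mapping.single a c * p)" for m
    using that keys_mult[of "Poly_Mapping.single a c" p] assms by auto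
  show "m \<in> Poly_Mapping.keys (Poly_Mapping.single a c * p)"
    if "m \<in> (+) a ` Poly_Mapping.keys p" for m
    using that assms by (auto simp: in_keys_iff lookup_single_mult)
qed

lemma single_one_power:
  "Poly_Mapping.single (Poly_Mapping.single v k) 1 = (mvar v :: 'k::field mpolynomial) ^ k"
  proof (induction k)
  case (Suc k)
  have "Poly_Mapping.single (Poly_Mapping.single v (Suc k)) 1
      = mvar v * Poly_Mapping.single (Poly_Mapping.single v k) (1 :: 'k)"
    by (simp add: mvar_def mult_single flip: single_add)
  then show ?case
    by (simp add: Suc)
qed simp

lemma single_one_sum:
  "finite A \<Longrightarrow> Poly_Mapping.single (\<Sum>v\<in>A. f v) (1 :: 'k::field)
    = (\<Prod>v\<in>A. Poly_Mapping.single (f v :: nat \<Rightarrow>\<^sub>0 nat) 1)"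
proof (induction A rule: finite_induct)
  case (insert v A)
  have "Poly_Mapping.single (a + b) (1 :: 'k) = Poly_Mapping.single a 1 * Poly_Mapping.single b 1"
    for a b :: "nat \<Rightarrow>\<^sub>0 nat"
    by (simp add: mult_single)
  then show ?case
    using insert by simp
qed simp

lemma single_eq_prod:
  fixes c :: "'k::field"
  shows "Poly_Mapping.single m c
    = mconst c * (\<Prod>v\<in>Poly_Mapping.keys m. mvar v ^ poly_mapping.lookup m v)"
proof -
  have "(\<Prod>v\<in>Poly_Mapping.keys m. mvar v ^ poly_mapping.lookup m v) = Poly_Mapping.single m (1::'k)"
    by (subst (3) sum_single_lookup[symmetric])
      (simp add: single_one_sum single_one_power)
  then show ?thesis
    by (simp add: mult_single)
qed

lemma mconst_mem: "mconst c \<in> polys n"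
  by (simp add: polys_def)

lemma mvar_mem: "v \<in> {1..n} \<Longrightarrow> mvar v \<in> polys n"
  by (simp add: polys_def mvar_def)

text \<open>Constants and variables generate the ring. Statements about substitutions can thus be
  proved without handling exponents.\<close>

lemma polys_induct [consumes 1, case_names const var add mult]:
  assumes "p \<in> polys n"
    and const: "\<And>c. P (mconst c)" and var: "\<And>v. v \<in> {1..n} \<Longrightarrow> P (mvar v)"
    and add: "\<And>p q. p \<in> polys n \<Longrightarrow> q \<in> polys n \<Longrightarrow> P p \<Longrightarrow> P q \<Longrightarrow> P (p + q)"
    and mult: "\<And>p q. p \<in> polys n \<Longrightarrow> q \<in> polys n \<Longrightarrow> P p \<Longrightarrow> P q \<Longrightarrow> P (p * q)"
  shows "P p"
proof -
  let ?P = "\<lambda>p. p \<in> polys n \<and> P p"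
  have sum: "?P (sum f A)" if "finite A" "\<And>i. i \<in> A \<Longrightarrow> ?P (f i)" for f and A :: "(nat \<Rightarrow>\<^sub>0 nat) set"
    using that const[of 0] by (induction A) (auto intro: add mpoly.add_mem mpoly.zero_mem)
  have power: "?P (q ^ k)" if "?P q" for q k
    using that const[of 1] by (induction k) (auto intro: mult mpoly.mult_mem mpoly.one_mem)
  have prod: "?P (prod f A)" if "finite A" "\<And>i. i \<in> A \<Longrightarrow> ?P (f i)" for f and A :: "nat set"
    using that const[of 1] by (induction A) (auto intro: mult mpoly.mult_mem mpoly.one_mem)
  have "?P (Poly_Mapping.single m (poly_mapping.lookup p m))" if m: "m \<in> Poly_Mapping.keys p" for m
  proof -
    have "v \<in> {1..n}" if "v \<in> Poly_Mapping.keys m" for v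
      using assms(1) m that unfolding polys_def by blast
    then have "?P (\<Prod>v\<in>Poly_Mapping.keys m. mvar v ^ poly_mapping.lookup m v)"
      by (intro prod power conjI var mvar_mem) auto
    then show ?thesis
      unfolding single_eq_prod[of m] using const mconst_mem by (auto intro: mult mpoly.mult_mem)
  qed
  then have "?P (\<Sum>m\<in>Poly_Mapping.keys p. Poly_Mapping.single m (poly_mapping.lookup p m))"
    by (intro sum) auto
  then show ?thesis
    by (simp add: sum_single_lookup)
qed

text \<open>For monotone \<open>Q\<close> this is the Stanley-Reisner ideal of the complex whose
  nonfaces are given by \<open>Q\<close>. Membership depends only on supports, so colon by a
  variable and adjunction of a variable become operations on \<open>Q\<close>.\<close>

definition monomial_ideal :: "nat \<Rightarrow> (nat set \<Rightarrow> bool) \<Rightarrow> 'k::field mpolynomial set" where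
  "monomial_ideal n Q = {p \<in> polys n. \<forall>m\<in>Poly_Mapping.keys p. Q (Poly_Mapping.keys m)}"

lemma is_ideal_monomial_ideal:
  assumes "mono Q"
  shows "mpoly.is_ideal n (monomial_ideal n Q)"
  unfolding mpoly.is_ideal_def
proof (intro conjI ballI)
  show "p + q \<in> monomial_ideal n Q" if "p \<in> monomial_ideal n Q" "q \<in> monomial_ideal n Q" for p q
    using that keys_add[of p q] by (auto simp: monomial_ideal_def mpoly.add_mem)
  show "r * p \<in> monomial_ideal n Q" if "r \<in> polys n" "p \<in> monomial_ideal n Q" for r p
  proof -
    have "Q (Poly_Mapping.keys m)" if m: "m \<in> Poly_Mapping.keys (r * p)" for m
    proof -
      obtain a b where "b \<in> Poly_Mapping.keys p" "m = a + b"
        using m keys_mult[of r p] by blast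
      then show ?thesis
        using \<open>p \<in> _\<close> monoD[OF assms, of "Poly_Mapping.keys b" "Poly_Mapping.keys m"]
        by (auto simp: monomial_ideal_def keys_add_nat le_bool_def)
    qed
    then show ?thesis
      using that by (simp add: monomial_ideal_def mpoly.mult_mem)
  qed
qed (auto simp: monomial_ideal_def mpoly.zero_mem)

text \<open>Multiplication by x_v inserts v into the support of every monomial and causes no
  cancellation; this computes the colon ideal.\<close>

lemma mvar_mult_mem_monomial_ideal_iff:
  assumes "v \<in> {1..n}" "p \<in> polys n"
  shows "mvar v * p \<in> monomial_ideal n Q \<longleftrightarrow> p \<in> monomial_ideal n (\<lambda>A. Q (insert v A))"
  using assms mpoly.mult_mem[OF mvar_mem[OF assms(1)] assms(2)]
  by (simp add: monomial_ideal_def mvar_def keys_single_mult keys_add_nat)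

lemma single_mem_monomial_ideal:
  "Poly_Mapping.keys m \<subseteq> {1..n} \<Longrightarrow> Q (Poly_Mapping.keys m) \<Longrightarrow>
    Poly_Mapping.single m c \<in> monomial_ideal n Q"
  by (simp add: monomial_ideal_def polys_def)

lemma monomial_ideal_subset:
  fixes I :: "'k::field mpolynomial set"
  assumes "mpoly.is_ideal n I"
    and "\<And>m c. Poly_Mapping.keys m \<subseteq> {1..n} \<Longrightarrow> Q (Poly_Mapping.keys m) \<Longrightarrow> Poly_Mapping.single m c \<in> I"
  shows "monomial_ideal n Q \<subseteq> I"
proof
  fix p :: "'k mpolynomial"
  assume "p \<in> monomial_ideal n Q"
  then have "(\<Sum>m\<in>Poly_Mapping.keys p. Poly_Mapping.single m (poly_mapping.lookup p m)) \<in> I"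
    using assms(2) by (intro mpoly.is_ideal_sum[OF assms(1)]) (auto simp: monomial_ideal_def polys_def)
  then show "p \<in> I"
    by (simp add: sum_single_lookup)
qed

lemma single_eq_mvar_mult:
  assumes "v \<in> Poly_Mapping.keys m"
  shows "Poly_Mapping.single m c = mvar v * Poly_Mapping.single (m - Poly_Mapping.single v 1) c"
    and "m = Poly_Mapping.single v 1 + (m - Poly_Mapping.single v 1)"
proof -
  show m: "m = Poly_Mapping.single v 1 + (m - Poly_Mapping.single v 1)"
    using assms by (intro poly_mapping_eqI)
      (auto simp: lookup_add lookup_minus lookup_single when_def in_keys_iff)
  show "Poly_Mapping.single m c = mvar v * Poly_Mapping.single (m - Poly_Mapping.single v 1) c"
    by (subst m) (simp add: mvar_def mult_single)
qed

lemma adjoin_mvar_monomial_ideal: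
  assumes "mono Q" "v \<in> {1..n}"
  shows "mpoly.adjoin n (monomial_ideal n Q) (mvar v :: 'k::field mpolynomial) = monomial_ideal n (\<lambda>A. Q A \<or> v \<in> A)"
proof (rule subset_antisym)
  have "mono (\<lambda>A. Q A \<or> v \<in> A)"
    using assms(1) by (auto simp: mono_def le_bool_def)
  note L = is_ideal_monomial_ideal[OF this]
  have "monomial_ideal n Q \<subseteq> monomial_ideal n (\<lambda>A. Q A \<or> v \<in> A)"
    by (auto simp: monomial_ideal_def)
  moreover have "mvar v \<in> monomial_ideal n (\<lambda>A. Q A \<or> v \<in> A)"
    unfolding mvar_def using assms(2) by (intro single_mem_monomial_ideal) auto
  ultimately show "mpoly.adjoin n (monomial_ideal n Q) (mvar v) \<subseteq> monomial_ideal n (\<lambda>A. Q A \<or> v \<in> A)"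
    using mpoly.foldl_adjoin_subset[OF L, where as = "[mvar v]"] by simp
next
  let ?L = "mpoly.adjoin n (monomial_ideal n Q) (mvar v :: 'k mpolynomial)"
  have L: "mpoly.is_ideal n ?L"
    using assms by (intro mpoly.is_ideal_adjoin is_ideal_monomial_ideal mvar_mem)
  show "monomial_ideal n (\<lambda>A. Q A \<or> v \<in> A) \<subseteq> ?L"
  proof (rule monomial_ideal_subset[OF L])
    fix m :: "nat \<Rightarrow>\<^sub>0 nat" and c :: 'k
    assume m: "Poly_Mapping.keys m \<subseteq> {1..n}" "Q (Poly_Mapping.keys m) \<or> v \<in> Poly_Mapping.keys m"
    from m(2) show "Poly_Mapping.single m c \<in> ?L"
    proof
      assume "Q (Poly_Mapping.keys m)"
      then show ?thesis
        using mpoly.subset_adjoin[of "monomial_ideal n Q"] single_mem_monomial_ideal[OF m(1)] by blast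
    next
      assume v: "v \<in> Poly_Mapping.keys m"
      have "Poly_Mapping.keys (m - Poly_Mapping.single v 1) \<subseteq> {1..n}"
        using m(1) by (subst (asm) single_eq_mvar_mult(2)[OF v]) (simp add: keys_add_nat)
      then have "Poly_Mapping.single (m - Poly_Mapping.single v 1) c \<in> polys n"
        by (simp add: polys_def)
      then show ?thesis
        unfolding single_eq_mvar_mult(1)[OF v] mult.commute[of "mvar v"]
        using mpoly.mem_adjoin[OF is_ideal_monomial_ideal[OF assms(1)]]
        by (intro mpoly.is_idealD(4)[OF L]) auto
    qed
  qed
qed

section \<open>Substitution homomorphisms\<close>

definition monomial_subst :: "(nat \<Rightarrow> 'k::field mpolynomial) \<Rightarrow> (nat \<Rightarrow>\<^sub>0 nat) \<Rightarrow> 'k mpolynomial" where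
  "monomial_subst g m = (\<Prod>v\<in>Poly_Mapping.keys m. g v ^ poly_mapping.lookup m v)"

definition mpoly_subst :: "(nat \<Rightarrow> 'k::field mpolynomial) \<Rightarrow> 'k mpolynomial \<Rightarrow> 'k mpolynomial" where
  "mpoly_subst g p = (\<Sum>m\<in>Poly_Mapping.keys p. mconst (poly_mapping.lookup p m) * monomial_subst g m)"

lemma monomial_subst_add: "monomial_subst g (a + b) = monomial_subst g a * monomial_subst g b"
proof -
  let ?A = "Poly_Mapping.keys a \<union> Poly_Mapping.keys b"
  have *: "monomial_subst g m = (\<Prod>v\<in>?A. g v ^ poly_mapping.lookup m v)" if "Poly_Mapping.keys m \<subseteq> ?A" for m
    unfolding monomial_subst_def using that
    by (intro prod.mono_neutral_left) (auto simp: in_keys_iff)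
  show ?thesis
    by (simp add: * keys_add_nat lookup_add power_add prod.distrib)
qed

lemma mpoly_subst_superset:
  assumes "finite A" "Poly_Mapping.keys p \<subseteq> A"
  shows "mpoly_subst g p = (\<Sum>m\<in>A. mconst (poly_mapping.lookup p m) * monomial_subst g m)"
  unfolding mpoly_subst_def using assms
  by (intro sum.mono_neutral_left) (auto simp: in_keys_iff)

lemma mpoly_subst_add: "mpoly_subst g (p + q) = mpoly_subst g p + mpoly_subst g q"
proof -
  let ?A = "Poly_Mapping.keys p \<union> Poly_Mapping.keys q"
  have "mpoly_subst g r = (\<Sum>m\<in>?A. mconst (poly_mapping.lookup r m) * monomial_subst g m)"
    if "Poly_Mapping.keys r \<subseteq> ?A" for r
    using that by (intro mpoly_subst_superset) auto
  then show ?thesis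
    using keys_add[of p q] by (simp add: lookup_add single_add distrib_right sum.distrib)
qed

lemma mpoly_subst_zero [simp]: "mpoly_subst g 0 = 0"
  by (simp add: mpoly_subst_def)

lemma mpoly_subst_sum: "mpoly_subst g (\<Sum>i\<in>A. f i) = (\<Sum>i\<in>A. mpoly_subst g (f i))"
  by (induction A rule: infinite_finite_induct) (simp_all add: mpoly_subst_add)

lemma mpoly_subst_single: "mpoly_subst g (Poly_Mapping.single m c) = mconst c * monomial_subst g m"
  by (cases "c = 0") (simp_all add: mpoly_subst_def)

lemma mpoly_subst_mult: "mpoly_subst g (p * q) = mpoly_subst g p * mpoly_subst g q"
proof -
  have "(\<Sum>a\<in>Poly_Mapping.keys p. Poly_Mapping.single a (poly_mapping.lookup p a)) *
      (\<Sum>b\<in>Poly_Mapping.keys q. Poly_Mapping.single b (poly_mapping.lookup q b)) = (\<Sum>a\<in>Poly_Mapping.keys p. \<Sum>b\<in>Poly_Mapping.keys q.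
      Poly_Mapping.single (a + b) (poly_mapping.lookup p a * poly_mapping.lookup q b))"
    by (simp add: sum_product mult_single)
  then have "p * q = (\<Sum>a\<in>Poly_Mapping.keys p. \<Sum>b\<in>Poly_Mapping.keys q.
      Poly_Mapping.single (a + b) (poly_mapping.lookup p a * poly_mapping.lookup q b))"
    by (simp only: sum_single_lookup)
  then show ?thesis
    by (simp add: mpoly_subst_sum mpoly_subst_single monomial_subst_add mpoly_subst_def[of g p]
        mpoly_subst_def[of g q] sum_product mult_single[of 0 _ 0, simplified, symmetric] ac_simps)
qed

lemma mpoly_subst_mconst [simp]: "mpoly_subst g (mconst c) = mconst c"
  by (simp add: mpoly_subst_single monomial_subst_def)

lemma mpoly_subst_mvar [simp]: "mpoly_subst g (mvar v) = g v"
  by (simp add: mvar_def mpoly_subst_single monomial_subst_def)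

lemma mpoly_subst_mem:
  assumes "p \<in> polys n" "\<And>v. v \<in> {1..n} \<Longrightarrow> g v \<in> polys n"
  shows "mpoly_subst g p \<in> polys n"
  using assms
  by (induction rule: polys_induct)
    (auto simp: mpoly_subst_add mpoly_subst_mult mconst_mem mpoly.add_mem mpoly.mult_mem)

text \<open>A substitution that is the identity modulo \<open>I\<close> on the variables is so
  everywhere. For products, pq - p'q' = q(p - p') + p'(q - q').\<close>

lemma diff_mpoly_subst_mem:
  assumes "mpoly.is_ideal n I" "p \<in> polys n"
    and g: "\<And>v. v \<in> {1..n} \<Longrightarrow> g v \<in> polys n" "\<And>v. v \<in> {1..n} \<Longrightarrow> mvar v - g v \<in> I"
  shows "p - mpoly_subst g p \<in> I"
  using assms(2)
proof (induction rule: polys_induct)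
  case (const c)
  show ?case
    using mpoly.is_idealD(2)[OF assms(1)] by simp
next
  case (add p q)
  then show ?case
    using mpoly.is_idealD(3)[OF assms(1) add(3,4)] by (simp add: mpoly_subst_add algebra_simps)
next
  case (mult p q)
  have "q * (p - mpoly_subst g p) + mpoly_subst g p * (q - mpoly_subst g q) \<in> I"
    using mult g(1) by (intro mpoly.is_idealD(3,4)[OF assms(1)] mpoly_subst_mem)
  then show ?case
    by (simp add: mpoly_subst_mult algebra_simps)
qed (simp add: g)

section \<open>Linear forms\<close>

lemma mconst_simps:
  "mconst (c + d) = mconst c + mconst d" "mconst (c - d) = mconst c - mconst d"
  "mconst (c * d) = mconst c * mconst d" "mconst (- c) = - mconst c"
  by (simp_all add: single_add single_diff single_uminus mult_single)

definition linear_form :: "nat \<Rightarrow> (nat \<Rightarrow> 'k) \<Rightarrow> 'k::field mpolynomial" where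
  "linear_form n \<mu> = (\<Sum>v\<in>{1..n}. mconst (\<mu> v) * mvar v)"

lemma single_one_eq_iff [simp]:
  "Poly_Mapping.single u (Suc 0) = Poly_Mapping.single v (Suc 0) \<longleftrightarrow> u = v"
proof
  assume "Poly_Mapping.single u (Suc 0) = Poly_Mapping.single v (Suc 0)"
  then have "poly_mapping.lookup (Poly_Mapping.single u (Suc 0)) v
      = poly_mapping.lookup (Poly_Mapping.single v (Suc 0)) v"
    by (rule arg_cong)
  then show "u = v"
    by (simp add: lookup_single when_def split: if_splits)
qed simp

lemma linear_form_add: "linear_form n \<mu> + linear_form n \<nu> = linear_form n (\<lambda>v. \<mu> v + \<nu> v)"
  by (simp add: linear_form_def mconst_simps distrib_right sum.distrib)

lemma linear_form_scale: "mconst c * linear_form n \<mu> = linear_form n (\<lambda>v. c * \<mu> v)"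
  by (simp add: linear_form_def mconst_simps sum_distrib_left mult.assoc)

lemma linear_form_zero: "linear_form n (\<lambda>v. 0) = 0"
  by (simp add: linear_form_def)

lemma sum_mvar_linear_form:
  assumes "A \<subseteq> {1..n}"
  shows "(\<Sum>v\<in>A. mvar v) = linear_form n (\<lambda>v. if v \<in> A then 1 else 0)"
proof -
  have "(\<Sum>v\<in>A. mvar v) = (\<Sum>v\<in>{1..n}. if v \<in> A then mvar v else 0)"
    using assms by (simp add: sum.If_cases Int_absorb1)
  also have "\<dots> = linear_form n (\<lambda>v. if v \<in> A then 1 else 0)"
    unfolding linear_form_def by (intro sum.cong) auto
  finally show ?thesis .
qed

lemma linear_form_mem: "linear_form n \<mu> \<in> polys n"
  unfolding linear_form_def by (intro mpoly.sum_mem mpoly.mult_mem mconst_mem mvar_mem)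

definition is_linear :: "nat \<Rightarrow> 'k::field mpolynomial \<Rightarrow> bool" where
  "is_linear n p \<longleftrightarrow> (\<exists>\<mu>. p = linear_form n \<mu>)"

lemma is_linear_mem: "is_linear n p \<Longrightarrow> p \<in> polys n"
  by (auto simp: is_linear_def linear_form_mem)

lemma is_linear_add: "is_linear n p \<Longrightarrow> is_linear n q \<Longrightarrow> is_linear n (p + q)"
  by (auto simp: is_linear_def linear_form_add)

lemma is_linear_scale: "is_linear n p \<Longrightarrow> is_linear n (mconst c * p)"
  by (auto simp: is_linear_def linear_form_scale)

lemma is_linear_zero: "is_linear n 0"
  unfolding is_linear_def by (intro exI[of _ "\<lambda>v. 0"]) (simp add: linear_form_zero)

lemma is_linear_sum: "(\<And>i. i \<in> A \<Longrightarrow> is_linear n (f i)) \<Longrightarrow> is_linear n (sum f A)"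
  by (induction A rule: infinite_finite_induct) (auto intro: is_linear_add is_linear_zero)

lemma is_linear_diff: "is_linear n p \<Longrightarrow> is_linear n q \<Longrightarrow> is_linear n (p - q)"
  using is_linear_add[of n p "mconst (- 1) * q"] is_linear_scale[of n q "- 1"]
  by (simp add: mconst_simps)

lemma is_linear_mvar: "v \<in> {1..n} \<Longrightarrow> is_linear n (mvar v)"
  using sum_mvar_linear_form[of "{v}" n] unfolding is_linear_def by auto

lemma is_linear_subst:
  assumes "is_linear n p" "\<And>v. v \<in> {1..n} \<Longrightarrow> is_linear n (g v)"
  shows "is_linear n (mpoly_subst g p)"
proof -
  from assms(1) obtain \<mu> where "p = linear_form n \<mu>"
    by (auto simp: is_linear_def)
  then have "mpoly_subst g p = (\<Sum>v\<in>{1..n}. mconst (\<mu> v) * g v)"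
    by (simp add: linear_form_def mpoly_subst_sum mpoly_subst_mult)
  then show ?thesis
    using assms(2) by (auto intro!: is_linear_sum is_linear_scale)
qed

text \<open>Presents the ideal \<open>I\<close> as the kernel of a retraction \<open>\<sigma>\<close> that is linear in the variables;
  in particular \<open>I\<close> is prime, generated by linear forms.\<close>

definition linear_retraction ::
    "nat \<Rightarrow> 'k::field mpolynomial set \<Rightarrow> ('k mpolynomial \<Rightarrow> 'k mpolynomial) \<Rightarrow> bool" where
  "linear_retraction n I \<sigma> \<longleftrightarrow>
    (\<forall>p q. \<sigma> (p + q) = \<sigma> p + \<sigma> q) \<and> (\<forall>p q. \<sigma> (p * q) = \<sigma> p * \<sigma> q) \<and> (\<forall>c. \<sigma> (mconst c) = mconst c) \<and>
    (\<forall>p. is_linear n p \<longrightarrow> is_linear n (\<sigma> p)) \<and> (\<forall>p\<in>polys n. \<sigma> p \<in> polys n) \<and>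
    (\<forall>p\<in>polys n. p - \<sigma> p \<in> I) \<and> (\<forall>p\<in>I. \<sigma> p = 0)"

lemma linear_retractionD:
  assumes "linear_retraction n I \<sigma>"
  shows "\<sigma> (p + q) = \<sigma> p + \<sigma> q" "\<sigma> (p * q) = \<sigma> p * \<sigma> q" "\<sigma> (mconst c) = mconst c"
    "is_linear n p \<Longrightarrow> is_linear n (\<sigma> p)" "p \<in> polys n \<Longrightarrow> \<sigma> p \<in> polys n"
    "p \<in> polys n \<Longrightarrow> p - \<sigma> p \<in> I" "p \<in> I \<Longrightarrow> \<sigma> p = 0"
  using assms by (auto simp: linear_retraction_def)

text \<open>A variable x_u with nonzero coefficient \<kappa>_u in the linear form \<sigma>(a) is
  eliminated: x_u goes to x_u - \<sigma>(a)/\<kappa>_u, which kills \<sigma>(a). That linear forms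
  change only by multiples of \<sigma>(a) is what later carries linear independence past
  \<open>a\<close>.\<close>

lemma linear_retraction_adjoin:
  assumes "linear_retraction n I \<sigma>" "mpoly.is_ideal n I" "is_linear n a" "\<sigma> a \<noteq> 0"
  shows "\<exists>\<tau>. linear_retraction n (mpoly.adjoin n I a) (\<lambda>p. \<tau> (\<sigma> p)) \<and>
    (\<forall>p. is_linear n p \<longrightarrow> (\<exists>c. \<tau> p = p - mconst c * \<sigma> a))"
proof -
  note \<sigma> = linear_retractionD[OF assms(1)]
  let ?L = "mpoly.adjoin n I a"
  have a: "a \<in> polys n"
    using assms(3) by (rule is_linear_mem)
  have L: "mpoly.is_ideal n ?L"
    using assms(2) a by (rule mpoly.is_ideal_adjoin)
  have linear: "is_linear n (\<sigma> a)"
    using assms(3) by (rule \<sigma>)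
  then obtain \<kappa> where \<kappa>: "\<sigma> a = linear_form n \<kappa>"
    by (auto simp: is_linear_def)
  have "\<exists>u\<in>{1..n}. \<kappa> u \<noteq> 0"
  proof (rule ccontr)
    assume "\<not> ?thesis"
    then have "\<sigma> a = 0"
      unfolding \<kappa> linear_form_def by (intro sum.neutral) auto
    then show False
      using assms(4) by simp
  qed
  then obtain u where u: "u \<in> {1..n}" "\<kappa> u \<noteq> 0"
    by blast
  define g where "g v = (if v = u then mvar v - mconst (1 / \<kappa> u) * \<sigma> a else mvar v)" for v
  have g_linear: "is_linear n (g v)" if "v \<in> {1..n}" for v
    using that linear by (auto simp: g_def intro!: is_linear_diff is_linear_scale is_linear_mvar)
  have g_mem: "g v \<in> polys n" if "v \<in> {1..n}" for v
    using g_linear[OF that] by (rule is_linear_mem)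
  have subst_linear: "mpoly_subst g (linear_form n \<mu>) = linear_form n \<mu> - mconst (\<mu> u / \<kappa> u) * \<sigma> a" for \<mu>
  proof -
    have "mpoly_subst g (linear_form n \<mu>) = (\<Sum>v\<in>{1..n}. mconst (\<mu> v) * mvar v
        - (if v = u then mconst (\<mu> u / \<kappa> u) * \<sigma> a else 0))"
      unfolding linear_form_def mpoly_subst_sum mpoly_subst_mult
      by (intro sum.cong) (auto simp: g_def algebra_simps mult_single simp flip: mult.assoc)
    also have "\<dots> = linear_form n \<mu> - mconst (\<mu> u / \<kappa> u) * \<sigma> a"
      using u by (simp add: sum_subtractf linear_form_def)
    finally show ?thesis .
  qed
  have "mpoly_subst g (\<sigma> a) = 0"
    using u(2) by (simp add: \<kappa> subst_linear)
  have \<sigma>a: "\<sigma> a \<in> ?L"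
  proof -
    have "a - (a - \<sigma> a) \<in> ?L"
      using L mpoly.mem_adjoin[OF assms(2)] subsetD[OF mpoly.subset_adjoin \<sigma>(6)[OF a]]
      by (rule mpoly.is_ideal_diff)
    then show ?thesis
      by simp
  qed
  show ?thesis
  proof (intro exI[of _ "mpoly_subst g"] conjI allI impI)
    show "\<exists>c. mpoly_subst g p = p - mconst c * \<sigma> a" if "is_linear n p" for p
      using that subst_linear unfolding is_linear_def by blast
    have "p - mpoly_subst g (\<sigma> p) \<in> ?L" if p: "p \<in> polys n" for p
    proof -
      have "\<sigma> p - mpoly_subst g (\<sigma> p) \<in> ?L"
      proof (rule diff_mpoly_subst_mem[OF L])
        show "\<sigma> p \<in> polys n"
          using p by (rule \<sigma>)
        show "g v \<in> polys n" if "v \<in> {1..n}" for v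
          using that by (rule g_mem)
        show "mvar v - g v \<in> ?L" for v
          using mpoly.is_idealD(2,4)[OF L] \<sigma>a mconst_mem by (auto simp: g_def)
      qed
      moreover have "p - \<sigma> p \<in> ?L"
        using subsetD[OF mpoly.subset_adjoin \<sigma>(6)[OF p]] .
      ultimately have "(p - \<sigma> p) + (\<sigma> p - mpoly_subst g (\<sigma> p)) \<in> ?L"
        by (intro mpoly.is_idealD(3)[OF L])
      then show ?thesis
        by simp
    qed
    moreover have "mpoly_subst g (\<sigma> p) = 0" if "p \<in> ?L" for p
      using that \<open>mpoly_subst g (\<sigma> a) = 0\<close>
      by (auto elim!: mpoly.adjoinE simp: \<sigma> mpoly_subst_add mpoly_subst_mult)
    ultimately show "linear_retraction n ?L (\<lambda>p. mpoly_subst g (\<sigma> p))"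
      using is_linear_subst[OF \<sigma>(4) g_linear] mpoly_subst_mem[OF \<sigma>(5) g_mem]
      by (simp add: linear_retraction_def \<sigma>(1-3) mpoly_subst_add mpoly_subst_mult)
  qed
qed

text \<open>Linear forms that stay linearly independent modulo an ideal generated by linear forms
  are regular: each quotient is a domain, and the next form is nonzero in it.\<close>

lemma weakly_regular_linear_retraction:
  fixes as :: "'k::field mpolynomial list"
  assumes "linear_retraction n I \<sigma>" "mpoly.is_ideal n I" "\<forall>a\<in>set as. is_linear n a"
    and "\<And>\<mu>. \<sigma> (\<Sum>i<length as. mconst (\<mu> i) * as ! i) = 0 \<Longrightarrow> \<forall>i<length as. \<mu> i = 0"
  shows "mpoly.weakly_regular n I as"
  using assms
proof (induction as arbitrary: I \<sigma>)
  case (Cons a as)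
  note \<sigma> = linear_retractionD[OF Cons.prems(1)]
  have a: "is_linear n a"
    using Cons.prems(3) by simp
  have nonzero: "\<sigma> a \<noteq> 0"
  proof
    assume 0: "\<sigma> a = 0"
    let ?\<mu> = "\<lambda>i. if i = 0 then 1 else 0 :: 'k"
    have "(\<Sum>i<length (a # as). mconst (?\<mu> i) * (a # as) ! i) = a"
      by (simp add: sum.lessThan_Suc_shift del: sum.lessThan_Suc)
    then have "\<sigma> (\<Sum>i<length (a # as). mconst (?\<mu> i) * (a # as) ! i) = 0"
      using 0 by (simp only:)
    then have "\<forall>i<length (a # as). ?\<mu> i = 0"
      by (rule Cons.prems(4))
    then show False
      by (auto dest: spec[of _ 0])
  qed
  obtain \<tau> where \<tau>: "linear_retraction n (mpoly.adjoin n I a) (\<lambda>p. \<tau> (\<sigma> p))"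
      "\<And>p. is_linear n p \<Longrightarrow> \<exists>c. \<tau> p = p - mconst c * \<sigma> a"
    using linear_retraction_adjoin[OF Cons.prems(1,2) a nonzero] by auto
  have "z \<in> I" if z: "z \<in> polys n" "a * z \<in> I" for z
  proof -
    have "\<sigma> a * \<sigma> z = 0"
      using \<sigma>(7)[OF z(2)] by (simp add: \<sigma>(2))
    \<comment> \<open>Polynomials over a field form a domain, so \<sigma>(z) = 0.\<close>
    then have "z - \<sigma> z = z"
      using nonzero by simp
    then show ?thesis
      using \<sigma>(6)[OF z(1)] by simp
  qed
  moreover have "mpoly.weakly_regular n (mpoly.adjoin n I a) as"
  proof (rule Cons.IH[OF \<tau>(1)])
    show "mpoly.is_ideal n (mpoly.adjoin n I a)"
      using Cons.prems(2) is_linear_mem[OF a] by (rule mpoly.is_ideal_adjoin)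
    show "\<forall>a\<in>set as. is_linear n a"
      using Cons.prems(3) by simp
    fix \<mu>
    let ?p = "\<Sum>i<length as. mconst (\<mu> i) * as ! i"
    assume "\<tau> (\<sigma> ?p) = 0"
    moreover have "is_linear n (\<sigma> ?p)"
      using Cons.prems(3) by (intro \<sigma>(4) is_linear_sum is_linear_scale) auto
    ultimately obtain c where "\<sigma> ?p - mconst c * \<sigma> a = 0"
      using \<tau>(2)[of "\<sigma> ?p"] by auto
    then have "mconst (- c) * \<sigma> a + \<sigma> ?p = 0"
      by (simp add: mconst_simps)
    \<comment> \<open>A relation among the remaining forms modulo \<open>a\<close> lifts to one that
      includes \<open>a\<close> with coefficient -c, to which the independence hypothesis
      applies.\<close>
    then have "\<sigma> (mconst (- c) * a + ?p) = 0"
      by (simp only: \<sigma>(1-3))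
    moreover have "(\<Sum>i<length (a # as). mconst (case i of 0 \<Rightarrow> - c | Suc j \<Rightarrow> \<mu> j) * (a # as) ! i)
        = mconst (- c) * a + ?p"
      by (simp add: sum.lessThan_Suc_shift del: sum.lessThan_Suc)
    ultimately have "\<sigma> (\<Sum>i<length (a # as). mconst (case i of 0 \<Rightarrow> - c | Suc j \<Rightarrow> \<mu> j) * (a # as) ! i) = 0"
      by (simp only:)
    then have "\<forall>i<length (a # as). (case i of 0 \<Rightarrow> - c | Suc j \<Rightarrow> \<mu> j) = 0"
      by (rule Cons.prems(4))
    then show "\<forall>i<length as. \<mu> i = 0"
      by (auto dest: spec[of _ "Suc _"])
  qed
  ultimately show ?case
    by simp
qed simp

text \<open>Setting the variables in \<open>W\<close> to 0 is a linear retraction. For u outside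
  \<open>W\<close>, the coefficient of x_u in a combination of the forms is the sum in the second
  hypothesis, which thus expresses linear independence of the forms modulo \<open>W\<close>.\<close>

lemma weakly_regular_mod_variables:
  fixes A :: "nat \<Rightarrow> nat set"
  assumes "\<And>i. i < d \<Longrightarrow> A i \<subseteq> {1..n}"
    and "\<And>\<mu> :: nat \<Rightarrow> 'k. (\<And>u. u \<in> {1..n} - W \<Longrightarrow> (\<Sum>i | i < d \<and> u \<in> A i. \<mu> i) = 0) \<Longrightarrow> \<forall>i<d. \<mu> i = 0"
  shows "mpoly.weakly_regular n (monomial_ideal n (\<lambda>B. B \<inter> W \<noteq> {}) :: 'k::field mpolynomial set)
    (map (\<lambda>i. \<Sum>v\<in>A i. mvar v) [0..<d])"
proof -
  define g :: "nat \<Rightarrow> 'k mpolynomial" where "g v = (if v \<in> W then 0 else mvar v)" for v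
  let ?I = "monomial_ideal n (\<lambda>B. B \<inter> W \<noteq> {}) :: 'k mpolynomial set"
  have I: "mpoly.is_ideal n ?I"
    by (intro is_ideal_monomial_ideal) (auto simp: mono_def le_bool_def)
  have g: "is_linear n (g v)" if "v \<in> {1..n}" for v
    using that by (simp add: g_def is_linear_mvar is_linear_zero)
  have g_mem: "g v \<in> polys n" if "v \<in> {1..n}" for v
    using g[OF that] by (rule is_linear_mem)
  have "p - mpoly_subst g p \<in> ?I" if "p \<in> polys n" for p
  proof (rule diff_mpoly_subst_mem[OF I that g_mem])
    show "mvar v - g v \<in> ?I" if "v \<in> {1..n}" for v
      using that mpoly.is_idealD(2)[OF I]
      by (auto simp: g_def mvar_def intro!: single_mem_monomial_ideal)
  qed
  moreover have "mpoly_subst g p = 0" if p: "p \<in> ?I" for p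
    unfolding mpoly_subst_def
  proof (intro sum.neutral ballI)
    fix m assume "m \<in> Poly_Mapping.keys p"
    then obtain v where "v \<in> Poly_Mapping.keys m" "v \<in> W"
      using p by (auto simp: monomial_ideal_def)
    then have "monomial_subst g m = 0"
      unfolding monomial_subst_def
      by (intro prod_zero bexI[of _ v]) (auto simp: g_def in_keys_iff)
    then show "mconst (poly_mapping.lookup p m) * monomial_subst g m = 0"
      by simp
  qed
  ultimately have "linear_retraction n ?I (mpoly_subst g)"
    using is_linear_subst[OF _ g] mpoly_subst_mem[OF _ g_mem]
    by (simp add: linear_retraction_def mpoly_subst_add mpoly_subst_mult)
  then show ?thesis
  proof (rule weakly_regular_linear_retraction[OF _ I])
    have "is_linear n (\<Sum>v\<in>A i. mvar v :: 'k mpolynomial)" if "i < d" for i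
      unfolding is_linear_def
      by (intro exI[of _ "\<lambda>v. if v \<in> A i then 1 else 0"]) (rule sum_mvar_linear_form[OF assms(1)[OF that]])
    then show "\<forall>a\<in>set (map (\<lambda>i. \<Sum>v\<in>A i. mvar v) [0..<d]). is_linear n (a :: 'k mpolynomial)"
      by simp
    fix \<mu> :: "nat \<Rightarrow> 'k"
    let ?a = "map (\<lambda>i. \<Sum>v\<in>A i. mvar v) [0..<d]"
    assume "mpoly_subst g (\<Sum>i<length ?a. mconst (\<mu> i) * ?a ! i) = 0"
    then have 0: "(\<Sum>i<d. \<Sum>v\<in>A i. mconst (\<mu> i) * g v) = 0"
      by (simp add: mpoly_subst_sum mpoly_subst_mult sum_distrib_left)
    have "(\<Sum>i | i < d \<and> u \<in> A i. \<mu> i) = 0" if u: "u \<in> {1..n} - W" for u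
    proof -
      have *: "poly_mapping.lookup (mconst (\<mu> i) * g v) (Poly_Mapping.single u 1) = (if v = u then \<mu> i else 0)"
        for v i
        using u by (auto simp: g_def mvar_def mult_single lookup_single when_def)
      have fin: "finite (A i)" if "i < d" for i
        using assms(1)[OF that] by (rule finite_subset) simp
      have "0 = poly_mapping.lookup (\<Sum>i<d. \<Sum>v\<in>A i. mconst (\<mu> i) * g v) (Poly_Mapping.single u 1)"
        by (simp add: 0)
      also have "\<dots> = (\<Sum>i<d. if u \<in> A i then \<mu> i else 0)"
        unfolding lookup_sum * using fin by (intro sum.cong) simp_all
      also have "\<dots> = (\<Sum>i | i < d \<and> u \<in> A i. \<mu> i)"
        by (simp add: sum.If_cases Int_def)
      finally show ?thesis
        by simp
    qed
    then show "\<forall>i<length ?a. \<mu> i = 0"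
      using assms(2)[of \<mu>] by simp
  qed
qed

section \<open>Cohomology of the cycle\<close>

definition list_monomial :: "nat list \<Rightarrow> (nat \<Rightarrow>\<^sub>0 nat)" where
  "list_monomial l = sum_list (map (\<lambda>v. Poly_Mapping.single v 1) l)"

lemma list_monomial_simps [simp]:
  "list_monomial [] = 0"
  "list_monomial (v # l) = Poly_Mapping.single v 1 + list_monomial l"
  by (simp_all add: list_monomial_def)

lemma keys_list_monomial: "Poly_Mapping.keys (list_monomial l) = set l"
  by (induction l) (simp_all add: keys_add_nat)

lemma koszul_mvar_single:
  fixes \<phi> :: "nat list \<Rightarrow> 'k::field"
  shows "koszul mvar (\<lambda>m. Poly_Mapping.single (a + list_monomial m) (\<phi> m)) l
    = Poly_Mapping.single (a + list_monomial l) (koszul (\<lambda>v. 1) \<phi> l)"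
proof (induction l arbitrary: a \<phi>)
  case (Cons v l)
  show ?case
    using Cons.IH[of "a + Poly_Mapping.single v 1" "\<lambda>m. \<phi> (v # m)"]
    by (simp add: mvar_def mult_single single_diff ac_simps)
qed simp

text \<open>Reading off the coefficient at the monomial of each list turns the Koszul differential
  into the simplicial coboundary, which has weight 1. The offset \<open>a\<close> collects the
  entries stripped from the list in the induction.\<close>

lemma lookup_koszul_mvar:
  fixes b :: "nat list \<Rightarrow> 'k::field mpolynomial"
  shows "poly_mapping.lookup (koszul mvar b l) (a + list_monomial l)
    = koszul (\<lambda>v. 1) (\<lambda>m. poly_mapping.lookup (b m) (a + list_monomial m)) l"
proof (induction l arbitrary: a b)
  case (Cons v l)
  have "poly_mapping.lookup (mvar v * b l) (a + (Poly_Mapping.single v 1 + list_monomial l))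
      = poly_mapping.lookup (b l) (a + list_monomial l)"
    using lookup_single_mult[of "Poly_Mapping.single v 1" 1 "b l" "a + list_monomial l"]
    by (simp add: mvar_def ac_simps)
  then show ?case
    using Cons.IH[of "\<lambda>m. b (v # m)" "a + Poly_Mapping.single v 1"]
    by (simp add: lookup_minus ac_simps)
qed simp

text \<open>The class is represented by l \<mapsto> \<phi>(l) x^l, with coboundary (d\<phi>)(l) x^l.
  For any \<open>b\<close>, its coefficients at the monomials x^m form a scalar cochain \<psi>;
  where d\<psi> and \<phi> differ on a face, x^l survives in the difference and lies outside the
  ideal.\<close>

lemma nonzero_cohomology_monomial_ideal:
  fixes \<phi> :: "nat list \<Rightarrow> 'k::field"
  assumes cocycle: "\<And>l. l \<in> lists {1..n} \<Longrightarrow> length l = Suc k \<Longrightarrow> \<not> Q (set l) \<Longrightarrow> koszul (\<lambda>v. 1) \<phi> l = 0"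
    and nontrivial: "\<And>\<psi>. \<exists>l\<in>lists {1..n}. length l = k \<and> \<not> Q (set l) \<and> koszul (\<lambda>v. 1) \<psi> l \<noteq> \<phi> l"
  shows "mpoly.nonzero_cohomology n mvar {1..n} (monomial_ideal n Q :: 'k mpolynomial set) k"
  unfolding mpoly.nonzero_cohomology_def
proof (intro exI[of _ "\<lambda>l. Poly_Mapping.single (list_monomial l) (\<phi> l)"] conjI ballI allI impI)
  fix l assume l: "l \<in> lists {1..n}"
  then show "Poly_Mapping.single (list_monomial l) (\<phi> l) \<in> polys n"
    by (auto simp: polys_def keys_list_monomial)
  assume "length l = Suc k"
  then have "Poly_Mapping.single (list_monomial l) (koszul (\<lambda>v. 1) \<phi> l) \<in> monomial_ideal n Q"
    using l cocycle[of l] by (auto simp: monomial_ideal_def polys_def keys_list_monomial)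
  then show "koszul mvar (\<lambda>l. Poly_Mapping.single (list_monomial l) (\<phi> l)) l \<in> monomial_ideal n Q"
    using koszul_mvar_single[of 0 \<phi> l] by simp
next
  fix b :: "nat list \<Rightarrow> 'k mpolynomial"
  define \<psi> where "\<psi> m = poly_mapping.lookup (b m) (list_monomial m)" for m
  obtain l where l: "l \<in> lists {1..n}" "length l = k" "\<not> Q (set l)" "koszul (\<lambda>v. 1) \<psi> l \<noteq> \<phi> l"
    using nontrivial by blast
  have "poly_mapping.lookup (Poly_Mapping.single (list_monomial l) (\<phi> l) - koszul mvar b l) (list_monomial l)
      = \<phi> l - koszul (\<lambda>v. 1) \<psi> l"
    using lookup_koszul_mvar[of b l 0] by (simp add: lookup_minus \<psi>_def[abs_def])
  then have "list_monomial l
      \<in> Poly_Mapping.keys (Poly_Mapping.single (list_monomial l) (\<phi> l) - koszul mvar b l)"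
    using l(4) by (simp add: in_keys_iff)
  then have "Poly_Mapping.single (list_monomial l) (\<phi> l) - koszul mvar b l \<notin> monomial_ideal n Q"
    using l(3) by (auto simp: monomial_ideal_def keys_list_monomial intro!: bexI[of _ "list_monomial l"])
  then show "\<exists>l\<in>lists {1..n}. length l = k \<and>
      Poly_Mapping.single (list_monomial l) (\<phi> l) - koszul mvar b l \<notin> monomial_ideal n Q"
    using l(1,2) by blast
qed

definition cycle_nonface :: "nat \<Rightarrow> nat set \<Rightarrow> bool" where
  "cycle_nonface n A \<longleftrightarrow> (\<exists>i\<in>{1..<n}. i \<in> A \<and> Suc i \<in> A) \<or> n \<in> A \<and> 1 \<in> A"

lemma mono_cycle_nonface: "mono (cycle_nonface n)"
  by (auto simp: mono_def le_bool_def cycle_nonface_def)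

lemma not_cycle_nonfaceD:
  assumes "\<not> cycle_nonface n A" "A \<subseteq> {1..n}"
  shows "i \<in> A \<Longrightarrow> Suc i \<notin> A" "n \<in> A \<Longrightarrow> 1 \<notin> A"
  using assms by (force simp: cycle_nonface_def)+

lemma not_cycle_nonfaceI: "sparse A \<Longrightarrow> n \<notin> A \<or> 1 \<notin> A \<Longrightarrow> \<not> cycle_nonface n A"
  by (auto simp: cycle_nonface_def sparse_def)

text \<open>Each independent set of the cycle misses some pair \<open>{3j-2, 3j}\<close> or is contained in the union
  of these pairs; so the wedge product of their indicator functions is a cocycle.\<close>

lemma nonzero_cohomology_cycle_mod_0_1:
  assumes n: "n = 3 * d \<or> n = 3 * d + 1" and d: "d \<ge> 1"
  shows "mpoly.nonzero_cohomology n mvar {1..n} (monomial_ideal n (cycle_nonface n) :: 'k::field mpolynomial set) d"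
proof -
  define \<alpha> :: "nat \<Rightarrow> nat \<Rightarrow> 'k" where "\<alpha> j v = (if v + 2 = 3 * j \<or> v = 3 * j then 1 else 0)" for j v
  define \<phi> where "\<phi> = wedge (map \<alpha> [1..<Suc d])"
  \<comment> \<open>The i-th pair is {3i+1, 3i+2}, counted from i = 0, and meets the (i+1)-st form:
    its value is 1 at 3i+1 and 0 at 3i+2, so every factor equals 1.\<close>
  have cross: "cross_eval 0 d \<phi> = 1"
    unfolding \<phi>_def by (subst cross_eval_wedge) (auto simp: \<alpha>_def simp del: upt_Suc)
  show ?thesis
  proof (rule nonzero_cohomology_monomial_ideal[where \<phi> = \<phi>])
    fix l assume l: "l \<in> lists {1..n}" "\<not> cycle_nonface n (set l)"
    define U where "U = set l"
    have U: "U \<subseteq> {1..n}"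
      using l by (auto simp: U_def)
    note indep = not_cycle_nonfaceD[OF l(2)[folded U_def] U]
    show "koszul (\<lambda>v. 1) \<phi> l = 0"
      unfolding \<phi>_def
    proof (rule wedge_cocycle, fold U_def, rule disjCI)
      assume "\<not> (\<forall>v\<in>U. (\<Sum>j\<in>set [1..<Suc d]. \<alpha> j v) = 1)"
      show "\<exists>j\<in>set [1..<Suc d]. \<forall>v\<in>U. \<alpha> j v = 0"
      proof (rule ccontr)
        assume "\<not> ?thesis"
        have meets: "3 * j - 2 \<in> U \<or> 3 * j \<in> U" if "j \<in> {1..d}" for j
        proof -
          have "j \<in> set [1..<Suc d]"
            using that by (simp del: upt_Suc)
          then obtain v where v: "v \<in> U" "\<alpha> j v \<noteq> 0"
            using \<open>\<not> (\<exists>j\<in>set [1..<Suc d]. _ j)\<close> by blast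
          then have "v = 3 * j - 2 \<or> v = 3 * j"
            by (auto simp: \<alpha>_def split: if_splits)
          then show ?thesis
            using v(1) by blast
        qed
        have "(\<Sum>j\<in>set [1..<Suc d]. \<alpha> j v) = 1" if v: "v \<in> U" for v
        proof -
          \<comment> \<open>If n = 3d+1 is in U, then 1 is not, so the first pair is met in 3; this
            excludes 4 and forces 6, and so on up to 3d, which is adjacent to n.\<close>
          have "v \<noteq> 3 * d + 1"
          proof
            assume v': "v = 3 * d + 1"
            then have "n \<in> U" "n = 3 * d + 1"
              using v U n by auto
            have "3 * Suc i \<in> U" if "Suc i \<le> d" for i
              using that
            proof (induction i)
              case 0
              show ?case
                using meets[of 1] d indep(2)[OF \<open>n \<in> U\<close>] by auto
            next
              case (Suc i)
              then show ?case
                using meets[of "Suc (Suc i)"] indep(1)[of "3 * Suc i"] by auto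
            qed
            then have "3 * d \<in> U"
              using d by (cases d) auto
            then show False
              using indep(1) v v' by auto
          qed
          then have v_le: "1 \<le> v" "v \<le> 3 * d"
            using v U n by auto
          \<comment> \<open>A vertex 3q+2 is adjacent to both elements of the pair {3q+1, 3q+3}, one
            of which is in U.\<close>
          have "v mod 3 \<noteq> 2"
          proof
            assume "v mod 3 = 2"
            then have "v = 3 * (v div 3) + 2"
              by presburger
            then have "v div 3 + 1 \<in> {1..d}" "3 * (v div 3 + 1) = Suc v" "v = Suc (3 * (v div 3 + 1) - 2)"
              using v_le by auto
            then show False
              using meets[of "v div 3 + 1"] indep(1)[of v] indep(1)[of "3 * (v div 3 + 1) - 2"] v by metis
          qed
          then have "v = 3 * (v div 3) \<or> v = 3 * (v div 3) + 1"
            by presburger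
          then obtain q where "v = 3 * q \<or> v = 3 * q + 1"
            by blast
          then have *: "v + 2 = 3 * j \<or> v = 3 * j \<longleftrightarrow> j = (v + 2) div 3" for j
            by auto
          have "(v + 2) div 3 \<in> {1..d}"
            using v_le by auto
          moreover have "set [1..<Suc d] = {1..d}"
            by (simp add: atLeastLessThanSuc_atLeastAtMost del: upt_Suc)
          ultimately show ?thesis
            unfolding \<alpha>_def * by (simp only: sum.delta finite_atLeastAtMost if_True)
        qed
        then show False
          using \<open>\<not> (\<forall>v\<in>U. _ v = 1)\<close> by blast
      qed
    qed
  next
    fix \<psi>
    show "\<exists>l\<in>lists {1..n}. length l = d \<and> \<not> cycle_nonface n (set l) \<and> koszul (\<lambda>v. 1) \<psi> l \<noteq> \<phi> l"
    proof (rule ccontr)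
      assume *: "\<not> ?thesis"
      have "cross_eval 0 d \<phi> = cross_eval 0 d (koszul (\<lambda>v. 1) \<psi>)"
      proof (rule cross_eval_cong)
        \<comment> \<open>The last pair ends at 3d-1 < n, so the edge from n to 1 is
          avoided.\<close>
        fix l assume l: "length l = d" "set l \<subseteq> {0<..<0 + 3 * d}" "sparse (set l)"
        then have "l \<in> lists {1..n}" "n \<notin> set l"
          using n by auto
        then show "\<phi> l = koszul (\<lambda>v. 1) \<psi> l"
          using * l not_cycle_nonfaceI[of "set l" n] by auto
      qed
      then show False
        using cross by (simp add: cross_eval_koszul)
    qed
  qed
qed

text \<open>Here the cocycle is the indicator of the maximal independent set \<open>{1, 4, \<dots>, n-1}\<close>.  If it were
  the coboundary of \<open>\<psi>\<close>, then \<open>\<psi>\<close> would be a cocycle on the path \<open>2, \<dots>, n\<close>, so it would vanish on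
  the cross-polytope in the link of \<open>1\<close>; but its coboundary does not vanish on the cone over it.\<close>

lemma nonzero_cohomology_cycle_mod_2:
  assumes n: "n = 3 * k + 2"
  shows "mpoly.nonzero_cohomology n mvar {1..n} (monomial_ideal n (cycle_nonface n) :: 'k::field mpolynomial set) (Suc k)"
proof -
  define \<alpha> :: "nat \<Rightarrow> nat \<Rightarrow> 'k" where "\<alpha> j v = (if v + 2 = 3 * j then 1 else 0)" for j v
  define \<phi> where "\<phi> = wedge (map \<alpha> [1..<Suc (Suc k)])"
  define \<omega> where "\<omega> = wedge (map \<alpha> [2..<Suc (Suc k)])"
  have "[1..<Suc (Suc k)] = 1 # [2..<Suc (Suc k)]"
    by (simp add: upt_conv_Cons numeral_2_eq_2 del: upt_Suc)
  then have \<phi>: "\<phi> = koszul (\<alpha> 1) \<omega>"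
    by (simp add: \<phi>_def \<omega>_def del: upt_Suc)
  \<comment> \<open>The pairs are now {3i+3, 3i+4}, and the form paired with the i-th one is the
    indicator of 3i+4: each factor is 0 - 1.\<close>
  have cross: "cross_eval 2 k \<omega> = (- 1) ^ k"
    unfolding \<omega>_def by (subst cross_eval_wedge) (auto simp: \<alpha>_def simp del: upt_Suc)
  show ?thesis
  proof (rule nonzero_cohomology_monomial_ideal[where \<phi> = \<phi>])
    fix l assume l: "l \<in> lists {1..n}" "\<not> cycle_nonface n (set l)"
    define U where "U = set l"
    have U: "U \<subseteq> {1..n}"
      using l by (auto simp: U_def)
    note indep = not_cycle_nonfaceD[OF l(2)[folded U_def] U]
    show "koszul (\<lambda>v. 1) \<phi> l = 0"
      unfolding \<phi>_def
    proof (rule wedge_cocycle, fold U_def, rule disjCI)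
      assume "\<not> (\<forall>v\<in>U. (\<Sum>j\<in>set [1..<Suc (Suc k)]. \<alpha> j v) = 1)"
      show "\<exists>j\<in>set [1..<Suc (Suc k)]. \<forall>v\<in>U. \<alpha> j v = 0"
      proof (rule ccontr)
        assume "\<not> ?thesis"
        \<comment> \<open>So U contains 1, 4, ..., 3k+1. Every other vertex is adjacent to one of
          these, hence U consists of them alone and the forms sum to 1 on U.\<close>
        have meets: "3 * j - 2 \<in> U" if "j \<in> {1..Suc k}" for j
        proof -
          have "j \<in> set [1..<Suc (Suc k)]"
            using that by (simp del: upt_Suc)
          then obtain v where v: "v \<in> U" "\<alpha> j v \<noteq> 0"
            using \<open>\<not> (\<exists>j\<in>set [1..<Suc (Suc k)]. _ j)\<close> by blast
          then have "v = 3 * j - 2"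
            by (auto simp: \<alpha>_def split: if_splits)
          then show ?thesis
            using v(1) by blast
        qed
        have "(\<Sum>j\<in>set [1..<Suc (Suc k)]. \<alpha> j v) = 1" if v: "v \<in> U" for v
        proof -
          have v_le: "1 \<le> v" "v \<le> 3 * k + 2"
            using v U n by auto
          have "v mod 3 \<noteq> 2"
          proof
            assume "v mod 3 = 2"
            then have "v = 3 * (v div 3) + 2"
              by presburger
            then have "v div 3 + 1 \<in> {1..Suc k}" "v = Suc (3 * (v div 3 + 1) - 2)"
              using v_le by auto
            then show False
              using meets[of "v div 3 + 1"] indep(1)[of "3 * (v div 3 + 1) - 2"] v by metis
          qed
          moreover have "v mod 3 \<noteq> 0"
          proof
            assume "v mod 3 = 0"
            then have "v = 3 * (v div 3)"
              by presburger
            then have "v div 3 + 1 \<in> {1..Suc k}" "3 * (v div 3 + 1) - 2 = Suc v"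
              using v_le by auto
            then show False
              using meets[of "v div 3 + 1"] indep(1)[of v] v by metis
          qed
          ultimately have "v = 3 * (v div 3) + 1"
            by presburger
          then obtain q where "v = 3 * q + 1"
            by blast
          then have *: "v + 2 = 3 * j \<longleftrightarrow> j = (v + 2) div 3" for j
            by auto
          have "(v + 2) div 3 \<in> {1..Suc k}"
            using v_le by auto
          moreover have "set [1..<Suc (Suc k)] = {1..Suc k}"
            by (simp add: atLeastLessThanSuc_atLeastAtMost del: upt_Suc)
          ultimately show ?thesis
            unfolding \<alpha>_def * by (simp only: sum.delta finite_atLeastAtMost if_True)
        qed
        then show False
          using \<open>\<not> (\<forall>v\<in>U. _ v = 1)\<close> by blast
      qed
    qed
  next
    fix \<psi>
    show "\<exists>l\<in>lists {1..n}. length l = Suc k \<and> \<not> cycle_nonface n (set l) \<and> koszul (\<lambda>v. 1) \<psi> l \<noteq> \<phi> l"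
    proof (rule ccontr)
      assume "\<not> ?thesis"
      then have *: "koszul (\<lambda>v. 1) \<psi> l = \<phi> l"
        if "l \<in> lists {1..n}" "length l = Suc k" "\<not> cycle_nonface n (set l)" for l
        using that by blast
      \<comment> \<open>The path 2, ..., 3k+2 = n has 3k+1 vertices, and \<phi> vanishes on it
        because its factor at vertex 1 does.\<close>
      have "cross_eval 2 k \<psi> = 0"
      proof (rule cross_eval_path_cocycle)
        fix l assume l: "length l = Suc k" "set l \<subseteq> {2..2 + 3 * k}" "sparse (set l)"
        then have "l \<in> lists {1..n}" "1 \<notin> set l"
          using n by auto
        then have "koszul (\<lambda>v. 1) \<psi> l = \<phi> l"
          using l by (intro * not_cycle_nonfaceI) auto
        also have "\<phi> l = 0"
          unfolding \<phi>_def using \<open>1 \<notin> set l\<close>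
          by (intro wedge_eq_0[of "\<alpha> 1"]) (auto simp: \<alpha>_def simp del: upt_Suc)
        finally show "koszul (\<lambda>v. 1) \<psi> l = 0" .
      qed
      \<comment> \<open>The pairs lie in 3, ..., 3k+1 and so avoid both neighbours 2 and n of 1.
        Expanding the left side at the prefix 1 gives the value at \<psi>, which is 0, minus that of
        a coboundary, while the right side is a sign.\<close>
      moreover have "cross_eval 2 k (\<lambda>m. koszul (\<lambda>v. 1) \<psi> (1 # m)) = cross_eval 2 k \<omega>"
      proof (rule cross_eval_cong)
        fix l assume l: "length l = k" "set l \<subseteq> {2<..<2 + 3 * k}" "sparse (set l)"
        then have "1 # l \<in> lists {1..n}" "n \<notin> set (1 # l)" "sparse (set (1 # l))"
          using n by (auto simp: sparse_def)
        then have "koszul (\<lambda>v. 1) \<psi> (1 # l) = \<phi> (1 # l)"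
          using l(1) by (intro * not_cycle_nonfaceI) auto
        also have "koszul (\<alpha> 1) (\<lambda>m. \<omega> (1 # m)) l = koszul (\<lambda>v. 0) (\<lambda>m. \<omega> (1 # m)) l"
          using l by (intro koszul_cong) (auto simp: \<alpha>_def)
        then have "\<phi> (1 # l) = \<omega> l"
          by (simp add: \<phi> koszul_weight_zero \<alpha>_def)
        finally show "koszul (\<lambda>v. 1) \<psi> (1 # l) = \<omega> l" .
      qed
      ultimately show False
        using cross by (simp add: cross_eval_diff cross_eval_koszul)
    qed
  qed
qed

section \<open>A regular sequence for the cycle\<close>

text \<open>The nonfaces of the ideal generated by the variables in \<open>W\<close> and the edge
  ideal of the path p, ..., m. The recursion stays within this family of ideals.\<close>

definition path_nonface :: "nat set \<Rightarrow> nat \<Rightarrow> nat \<Rightarrow> nat set \<Rightarrow> bool" where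
  "path_nonface W p m A \<longleftrightarrow> A \<inter> W \<noteq> {} \<or> (\<exists>i\<in>{p..<m}. i \<in> A \<and> Suc i \<in> A)"

lemma mono_path_nonface: "mono (path_nonface W p m)"
  by (auto simp: mono_def le_bool_def path_nonface_def)

lemma weakly_regular_split:
  fixes as :: "'k::field mpolynomial list"
  assumes "v \<in> {1..n}" "set as \<subseteq> polys n" "mono Q" "mono Q'"
    and "\<And>A. Q (insert v A) \<longleftrightarrow> Q' A" "\<And>A. Q A \<or> v \<in> A \<longleftrightarrow> Q'' A"
    and "mpoly.weakly_regular n (monomial_ideal n Q') as"
    and "mpoly.weakly_regular n (monomial_ideal n Q'') as"
  shows "mpoly.weakly_regular n (monomial_ideal n Q) as"
proof (rule mpoly.weakly_regular_colon)
  show "mpoly.is_ideal n (monomial_ideal n Q :: 'k mpolynomial set)"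
    "mpoly.is_ideal n (monomial_ideal n Q' :: 'k mpolynomial set)"
    using assms(3,4) by (auto intro: is_ideal_monomial_ideal)
  show "mvar v \<in> polys n"
    using assms(1) by (rule mvar_mem)
  show "mpoly.weakly_regular n (mpoly.adjoin n (monomial_ideal n Q) (mvar v)) as"
    using assms(1,3,6,8) by (simp add: adjoin_mvar_monomial_ideal)
  show "mvar v * z \<in> monomial_ideal n Q \<longleftrightarrow> z \<in> monomial_ideal n Q'" if "z \<in> polys n" for z
    using mvar_mult_mem_monomial_ideal_iff[OF assms(1) that] assms(5) by simp
qed (use assms in auto)

text \<open>The split is at p+1, the neighbour of the end p. The colon keeps p+1, which dominates p,
  p+1 and p+2; adjoining x_{p+1} isolates p, which dominates p and p+1. The rest of the path is
  handled by induction. A split at p would leave p undominated if p were deleted and p+1 were not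
  kept later.\<close>

lemma weakly_regular_path:
  fixes as :: "'k::field mpolynomial list"
  assumes "1 \<le> p" "m \<le> n" "W \<inter> {p..m} = {}" "set as \<subseteq> polys n"
    and "\<And>W'. W \<subseteq> W' \<Longrightarrow> W' \<subseteq> W \<union> {p..m} \<Longrightarrow>
      (\<And>c. c \<in> {p..m} \<Longrightarrow> \<exists>u\<in>{p..m} - W'. u \<le> Suc c \<and> c \<le> Suc u) \<Longrightarrow>
      mpoly.weakly_regular n (monomial_ideal n (\<lambda>A. A \<inter> W' \<noteq> {})) as"
  shows "mpoly.weakly_regular n (monomial_ideal n (path_nonface W p m)) as"
  using assms
proof (induction "Suc m - p" arbitrary: p W rule: less_induct)
  case less
  note leaf = less.prems(5)
  show ?case
  proof (cases "p < m")
    case False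
    then have "path_nonface W p m = (\<lambda>A. A \<inter> W \<noteq> {})"
      by (auto simp: path_nonface_def fun_eq_iff)
    moreover have "mpoly.weakly_regular n (monomial_ideal n (\<lambda>A. A \<inter> W \<noteq> {})) as"
    proof (rule leaf)
      fix c assume "c \<in> {p..m}"
      then show "\<exists>u\<in>{p..m} - W. u \<le> Suc c \<and> c \<le> Suc u"
        using False less.prems(3) by (intro bexI[of _ c]) auto
    qed auto
    ultimately show ?thesis
      by simp
  next
    case True
    have notin: "p \<notin> W" "Suc p \<notin> W"
      using less.prems(3) True by auto
    \<comment> \<open>The intersection drops p+2 when the path already ends at p+1.\<close>
    let ?W1 = "W \<union> ({p, p + 2} \<inter> {p..m})" and ?W2 = "insert (Suc p) W"
    show ?thesis
    proof (rule weakly_regular_split[where v = "Suc p"])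
      show "mpoly.weakly_regular n (monomial_ideal n (path_nonface ?W1 (p + 3) m)) as"
      proof (rule less.hyps)
        fix W' assume W': "?W1 \<subseteq> W'" "W' \<subseteq> ?W1 \<union> {p + 3..m}"
          and dom: "\<And>c. c \<in> {p + 3..m} \<Longrightarrow> \<exists>u\<in>{p + 3..m} - W'. u \<le> Suc c \<and> c \<le> Suc u"
        show "mpoly.weakly_regular n (monomial_ideal n (\<lambda>A. A \<inter> W' \<noteq> {})) as"
        proof (rule leaf)
          fix c assume c: "c \<in> {p..m}"
          show "\<exists>u\<in>{p..m} - W'. u \<le> Suc c \<and> c \<le> Suc u"
          proof (cases "c \<le> p + 2")
            case True
            then show ?thesis
              using c W' notin \<open>p < m\<close> by (intro bexI[of _ "Suc p"]) auto
          next
            case False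
            then have "c \<in> {p + 3..m}"
              using c by auto
            from dom[OF this] show ?thesis
              by fastforce
          qed
        qed (use W' in auto)
      qed (use less.prems True in auto)
      show "mpoly.weakly_regular n (monomial_ideal n (path_nonface ?W2 (p + 2) m)) as"
      proof (rule less.hyps)
        fix W' assume W': "?W2 \<subseteq> W'" "W' \<subseteq> ?W2 \<union> {p + 2..m}"
          and dom: "\<And>c. c \<in> {p + 2..m} \<Longrightarrow> \<exists>u\<in>{p + 2..m} - W'. u \<le> Suc c \<and> c \<le> Suc u"
        show "mpoly.weakly_regular n (monomial_ideal n (\<lambda>A. A \<inter> W' \<noteq> {})) as"
        proof (rule leaf)
          fix c assume c: "c \<in> {p..m}"
          show "\<exists>u\<in>{p..m} - W'. u \<le> Suc c \<and> c \<le> Suc u"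
          proof (cases "c \<le> p + 1")
            case True
            then show ?thesis
              using c W' notin by (intro bexI[of _ p]) auto
          next
            case False
            then have "c \<in> {p + 2..m}"
              using c by auto
            from dom[OF this] show ?thesis
              by fastforce
          qed
        qed (use W' \<open>p < m\<close> in auto)
      qed (use less.prems True in auto)
      show "path_nonface W p m (insert (Suc p) A) \<longleftrightarrow> path_nonface ?W1 (p + 3) m A" for A
      proof
        assume "path_nonface W p m (insert (Suc p) A)"
        then consider "A \<inter> W \<noteq> {}" | i where "p \<le> i" "i < m" "i \<in> insert (Suc p) A" "Suc i \<in> insert (Suc p) A"
          unfolding path_nonface_def Bex_def atLeastLessThan_iff using notin(2) by blast
        then show "path_nonface ?W1 (p + 3) m A"
        proof cases
          case 2
          then consider "i = p" | "i = Suc p" | "i = p + 2" | "p + 3 \<le> i"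
            by linarith
          then show ?thesis
            using 2 by cases (auto simp: path_nonface_def)
        qed (auto simp: path_nonface_def)
      next
        assume "path_nonface ?W1 (p + 3) m A"
        then consider "A \<inter> W \<noteq> {}" | "p \<in> A" | "p + 2 \<in> A" "p + 2 \<le> m"
          | i where "p + 3 \<le> i" "i < m" "i \<in> A" "Suc i \<in> A"
          by (auto simp: path_nonface_def)
        then show "path_nonface W p m (insert (Suc p) A)"
        proof cases
          case 2
          then show ?thesis
            using True by (auto simp: path_nonface_def)
        next
          case 3
          then show ?thesis
            by (auto simp: path_nonface_def intro!: bexI[of _ "Suc p"])
        next
          case 4
          then show ?thesis
            by (auto simp: path_nonface_def intro!: bexI[of _ i])
        qed (auto simp: path_nonface_def)
      qed
      show "path_nonface W p m A \<or> Suc p \<in> A \<longleftrightarrow> path_nonface ?W2 (p + 2) m A" for A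
      proof -
        have "i = p \<or> i = Suc p \<or> p + 2 \<le> i" if "p \<le> i" for i
          using that by linarith
        then show ?thesis
          unfolding path_nonface_def by fastforce
      qed
    qed (use less.prems True mono_path_nonface in auto)
  qed
qed

text \<open>Splitting off \<open>x\<^sub>n\<close> leaves a path in both cases.  The vertex set of each leaf of the recursion
  is independent and dominates every vertex, except that it may miss the neighbourhood of \<open>n\<close>.\<close>

lemma weakly_regular_cycle:
  fixes as :: "'k::field mpolynomial list"
  assumes n: "n \<ge> 3" and as: "set as \<subseteq> polys n"
    and leaf: "\<And>W. (\<And>c. c \<in> {1..n - 1} \<Longrightarrow>
        \<exists>u\<in>{1..n} - W. u \<le> Suc c \<and> c \<le> Suc u \<or> c = 1 \<and> u = n) \<Longrightarrow>
      mpoly.weakly_regular n (monomial_ideal n (\<lambda>A. A \<inter> W \<noteq> {})) as"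
  shows "mpoly.weakly_regular n (monomial_ideal n (cycle_nonface n)) as"
proof (rule weakly_regular_split[where v = n])
  \<comment> \<open>In the colon by x_n, the kept vertex n dominates its neighbours 1 and n-1, now
    variables of the ideal; the clause \<open>c = 1 \<and> u = n\<close> records the adjacency
    across the end of the numbering.\<close>
  show "mpoly.weakly_regular n (monomial_ideal n (path_nonface {1, n - 1} 2 (n - 2))) as"
  proof (rule weakly_regular_path)
    fix W assume W: "{1, n - 1} \<subseteq> W" "W \<subseteq> {1, n - 1} \<union> {2..n - 2}"
      and dom: "\<And>c. c \<in> {2..n - 2} \<Longrightarrow> \<exists>u\<in>{2..n - 2} - W. u \<le> Suc c \<and> c \<le> Suc u"
    show "mpoly.weakly_regular n (monomial_ideal n (\<lambda>A. A \<inter> W \<noteq> {})) as"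
    proof (rule leaf)
      fix c assume c: "c \<in> {1..n - 1}"
      show "\<exists>u\<in>{1..n} - W. u \<le> Suc c \<and> c \<le> Suc u \<or> c = 1 \<and> u = n"
      proof (cases "c = 1 \<or> c = n - 1")
        case True
        have "n \<notin> W"
          using W n by auto
        then show ?thesis
          using True n by (intro bexI[of _ n]) auto
      next
        case False
        then have "c \<in> {2..n - 2}"
          using c by auto
        from dom[OF this] show ?thesis
          by fastforce
      qed
    qed
  qed (use n as in auto)
  show "mpoly.weakly_regular n (monomial_ideal n (path_nonface {n} 1 (n - 1))) as"
  proof (rule weakly_regular_path)
    fix W assume "\<And>c. c \<in> {1..n - 1} \<Longrightarrow> \<exists>u\<in>{1..n - 1} - W. u \<le> Suc c \<and> c \<le> Suc u"
    then show "mpoly.weakly_regular n (monomial_ideal n (\<lambda>A. A \<inter> W \<noteq> {})) as"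
      by (intro leaf) fastforce
  qed (use n as in auto)
  show "cycle_nonface n (insert n A) \<longleftrightarrow> path_nonface {1, n - 1} 2 (n - 2) A" for A
  proof
    assume "cycle_nonface n (insert n A)"
    moreover have "n \<noteq> 1"
      using n by simp
    moreover have "1 \<le> i \<and> i < n \<and> i \<in> A \<and> (Suc i = n \<or> Suc i \<in> A)"
      if "i \<in> {1..<n}" "i \<in> insert n A" "Suc i \<in> insert n A" for i
      using that by auto
    ultimately have "1 \<in> A \<or> (\<exists>i. 1 \<le> i \<and> i < n \<and> i \<in> A \<and> (Suc i = n \<or> Suc i \<in> A))"
      using \<open>n \<noteq> 1\<close> unfolding cycle_nonface_def by blast
    then consider "1 \<in> A" | i where "1 \<le> i" "i < n" "i \<in> A" "Suc i = n \<or> Suc i \<in> A"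
      by blast
    then show "path_nonface {1, n - 1} 2 (n - 2) A"
    proof cases
      case 2
      then consider "i = 1" | "i = n - 1" | "Suc i = n - 1" "Suc i \<in> A" | "2 \<le> i" "i < n - 2" "Suc i \<in> A"
        by linarith
      then show ?thesis
        using 2 by cases (auto simp: path_nonface_def)
    qed (auto simp: path_nonface_def)
  next
    assume "path_nonface {1, n - 1} 2 (n - 2) A"
    then consider "1 \<in> A" | "n - 1 \<in> A" | i where "2 \<le> i" "i < n - 2" "i \<in> A" "Suc i \<in> A"
      by (auto simp: path_nonface_def)
    then show "cycle_nonface n (insert n A)"
    proof cases
      case 2
      then show ?thesis
        using n by (auto simp: cycle_nonface_def intro!: bexI[of _ "n - 1"])
    next
      case 3
      then show ?thesis
        by (auto simp: cycle_nonface_def intro!: bexI[of _ i])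
    qed (auto simp: cycle_nonface_def)
  qed
  show "cycle_nonface n A \<or> n \<in> A \<longleftrightarrow> path_nonface {n} 1 (n - 1) A" for A
  proof
    assume "cycle_nonface n A \<or> n \<in> A"
    then consider "n \<in> A" | i where "1 \<le> i" "i < n" "i \<in> A" "Suc i \<in> A"
      by (auto simp: cycle_nonface_def)
    then show "path_nonface {n} 1 (n - 1) A"
    proof cases
      case 2
      then consider "Suc i = n" | "i < n - 1"
        by linarith
      then show ?thesis
        using 2 by cases (auto simp: path_nonface_def)
    qed (auto simp: path_nonface_def)
  next
    assume "path_nonface {n} 1 (n - 1) A"
    then show "cycle_nonface n A \<or> n \<in> A"
      by (auto simp: path_nonface_def cycle_nonface_def)
  qed
qed (use n as mono_cycle_nonface mono_path_nonface in auto)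

text \<open>If \<open>n\<close> is \<open>3d\<close> or \<open>3d+1\<close>, the supports are the closed neighbourhoods of \<open>2, 5, \<dots>, 3d-1\<close>.  If
  \<open>n = 3d-1\<close>, there is no room for \<open>d\<close> of them, and consecutive supports overlap in one vertex.\<close>

definition cycle_form_support :: "nat \<Rightarrow> nat \<Rightarrow> nat set" where
  "cycle_form_support n i =
    (if n mod 3 = 2 then {u \<in> {1..<n}. u \<le> 3 * i + 2 \<and> 3 * i \<le> Suc u} \<union> (if i = 0 then {n} else {})
     else {3 * i + 1..3 * i + 3})"

text \<open>For n = 3d or 3d+1, domination of 3i+2 yields a vertex lying in the i-th support only.
  For n = 3d-1, a kept vertex 3i or 3i+1 below n gives \<mu>_i = 0, a kept vertex 3i+2 below n gives
  \<mu>_i + \<mu>_(i+1) = 0, and n, which belongs only to support 0, gives \<mu>_0 = 0. A nonzero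
  coefficient then spreads along the whole chain and contradicts the condition at n.\<close>

lemma cycle_forms_independent:
  fixes \<mu> :: "nat \<Rightarrow> 'k::field"
  assumes n: "n \<ge> 3" "3 * d \<le> Suc n" "n \<le> 3 * d + 1"
    and dom: "\<And>c. c \<in> {1..n - 1} \<Longrightarrow> \<exists>u\<in>{1..n} - W. u \<le> Suc c \<and> c \<le> Suc u \<or> c = 1 \<and> u = n"
    and zero: "\<And>u. u \<in> {1..n} - W \<Longrightarrow> (\<Sum>i | i < d \<and> u \<in> cycle_form_support n i. \<mu> i) = 0"
  shows "\<forall>i<d. \<mu> i = 0"
proof (cases "n mod 3 = 2")
  case False
  have "\<mu> i = 0" if i: "i < d" for i
  proof -
    have "3 * d \<le> n"
      using False n by presburger
    then have "3 * i + 2 \<in> {1..n - 1}"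
      using i by auto
    from dom[OF this] obtain u where u: "u \<in> {1..n} - W" "u \<in> {3 * i + 1..3 * i + 3}"
      by auto
    then have "{j. j < d \<and> u \<in> cycle_form_support n j} = {i}"
      using i False by (auto simp: cycle_form_support_def)
    then show ?thesis
      using zero[OF u(1)] by simp
  qed
  then show ?thesis
    by blast
next
  case True
  then have nd: "n = 3 * d - 1" and d: "d \<ge> 2"
    using n by presburger+
  have eqs: "\<mu> i = 0" if "u \<in> {1..n} - W" "u < n" "u = 3 * i \<or> u = 3 * i + 1" for u i
  proof -
    have "{j. j < d \<and> u \<in> cycle_form_support n j} = {i}"
      using that nd True by (auto simp: cycle_form_support_def split: if_splits)
    then show ?thesis
      using zero[OF that(1)] by simp
  qed
  have eqs2: "\<mu> i + \<mu> (Suc i) = 0" if "u \<in> {1..n} - W" "u < n" "u = 3 * i + 2" for u i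
  proof -
    have "{j. j < d \<and> u \<in> cycle_form_support n j} = {i, Suc i}"
      using that nd True by (auto simp: cycle_form_support_def split: if_splits)
    then show ?thesis
      using zero[OF that(1)] by simp
  qed
  have eqn: "\<mu> 0 = 0" if "n \<in> {1..n} - W"
  proof -
    have "{j. j < d \<and> n \<in> cycle_form_support n j} = {0}"
      using True d by (auto simp: cycle_form_support_def split: if_splits)
    then show ?thesis
      using zero[OF that] by simp
  qed
  \<comment> \<open>Domination of 3i+1: the kept vertex cannot be 3i or 3i+1, so it is 3i+2, or n
    when i = 0. For i = d-1 the vertex 3i+2 is n itself, hence the second alternative.\<close>
  have right: "Suc i < d \<and> \<mu> (Suc i) \<noteq> 0 \<or> Suc i = d \<and> \<mu> 0 = 0" if i: "i < d" "\<mu> i \<noteq> 0" for i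
  proof -
    have "3 * i + 1 \<in> {1..n - 1}"
      using i nd by auto
    from dom[OF this] obtain u where u: "u \<in> {1..n} - W"
      "u \<le> Suc (3 * i + 1) \<and> 3 * i + 1 \<le> Suc u \<or> 3 * i + 1 = 1 \<and> u = n"
      by blast
    have neq: "u < n \<longrightarrow> u \<noteq> 3 * i \<and> u \<noteq> 3 * i + 1"
      using eqs[OF u(1), of i] i by auto
    have "u = 3 * i + 2 \<or> i = 0 \<and> u = n"
    proof (cases "i = 0 \<and> u = n")
      case False
      then have "3 * i \<le> u" "u \<le> 3 * i + 2"
        using u(2) by auto
      moreover have "3 * i + 1 < n"
        using i(1) nd by auto
      ultimately show ?thesis
        using neq by linarith
    qed simp
    then show ?thesis
      using eqs2[OF u(1), of i] eqn u(1) i nd by (cases "u < n") auto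
  qed
  \<comment> \<open>Domination of 3i+3: the kept vertex cannot be 3i+3 or 3i+4, so it is
    3i+2.\<close>
  have left: "\<mu> i \<noteq> 0" if i: "Suc i < d" "\<mu> (Suc i) \<noteq> 0" for i
  proof -
    have "3 * Suc i \<in> {1..n - 1}"
      using i nd by auto
    from dom[OF this] obtain u where u: "u \<in> {1..n} - W" "u \<in> {3 * i + 2..3 * i + 4}"
      by auto
    then have "u < n"
      using i nd by auto
    then have "u \<noteq> 3 * Suc i \<and> u \<noteq> 3 * Suc i + 1"
      using eqs[OF u(1), of "Suc i"] i by auto
    then have "u = 3 * i + 2"
      using u(2) by auto
    then show ?thesis
      using eqs2[OF u(1) \<open>u < n\<close>] i(2) by auto
  qed
  show ?thesis
  proof (rule ccontr)
    assume "\<not> ?thesis"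
    then obtain i where i: "i < d" "\<mu> i \<noteq> 0"
      by auto
    then have 0: "\<mu> 0 \<noteq> 0"
      by (induction i) (use left in auto)
    have "\<mu> j \<noteq> 0" if "j < d" for j
      using that by (induction j) (use 0 right in auto)
    then show False
      using right[of "d - 1"] 0 d by auto
  qed
qed

section \<open>Identification of the ideals, and the depth\<close>

lemma mpoly_ring_eq: "mpoly_ring n = mpoly.subring_record n"
  unfolding mpoly_ring_def mpoly.subring_record_def by (simp add: polys_def)

lemma cycle_edge_ideal_eq:
  assumes n: "n \<ge> 3"
  shows "cycle_edge_ideal n = (monomial_ideal n (cycle_nonface n) :: 'k::field mpolynomial set)"
proof (rule subset_antisym)
  let ?G = "{mvar i * mvar (i + 1) | i. i \<in> {1..<n}} \<union> {mvar n * mvar 1} :: 'k mpolynomial set"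
  have edge: "mvar i * mvar j \<in> monomial_ideal n (cycle_nonface n)"
    if "{i, j} \<subseteq> {1..n}" "cycle_nonface n {i, j}" for i j
    using that by (simp add: mvar_def mult_single monomial_ideal_def polys_def keys_add_nat insert_commute)
  have "?G \<subseteq> monomial_ideal n (cycle_nonface n)"
  proof
    fix g assume "g \<in> ?G"
    then consider i where "i \<in> {1..<n}" "g = mvar i * mvar (i + 1)" | "g = mvar n * mvar 1"
      by blast
    then show "g \<in> monomial_ideal n (cycle_nonface n)"
    proof cases
      case 1
      then have "cycle_nonface n {i, i + 1}"
        by (auto simp: cycle_nonface_def intro!: bexI[of _ i])
      then show ?thesis
        using 1 edge[of i "i + 1"] by simp
    next
      case 2
      then show ?thesis
        using n edge[of n 1] by (simp add: cycle_nonface_def)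
    qed
  qed
  then show "cycle_edge_ideal n \<subseteq> (monomial_ideal n (cycle_nonface n) :: 'k mpolynomial set)"
    unfolding cycle_edge_ideal_def mpoly_ring_eq
    by (intro mpoly.genideal_subring_record_minimal is_ideal_monomial_ideal mono_cycle_nonface)
  have "?G \<subseteq> polys n"
    using n by (auto intro!: mpoly.mult_mem mvar_mem)
  note J = mpoly.is_ideal_genideal_subring_record[OF this]
  have "?G \<subseteq> cycle_edge_ideal n"
    unfolding cycle_edge_ideal_def genideal_def by blast
  note G = subsetD[OF this]
  show "monomial_ideal n (cycle_nonface n) \<subseteq> (cycle_edge_ideal n :: 'k mpolynomial set)"
  proof (rule monomial_ideal_subset)
    show J': "mpoly.is_ideal n (cycle_edge_ideal n :: 'k mpolynomial set)"
      unfolding cycle_edge_ideal_def mpoly_ring_eq by (rule J)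
    fix m :: "nat \<Rightarrow>\<^sub>0 nat" and c :: 'k
    assume m: "Poly_Mapping.keys m \<subseteq> {1..n}" "cycle_nonface n (Poly_Mapping.keys m)"
    then obtain i j where ij: "i \<in> Poly_Mapping.keys m" "j \<in> Poly_Mapping.keys m" "i \<noteq> j"
      "mvar i * mvar j \<in> ?G"
      using n by (fastforce simp: cycle_nonface_def)
    let ?m = "m - Poly_Mapping.single i 1"
    let ?m' = "?m - Poly_Mapping.single j 1"
    \<comment> \<open>The endpoints are distinct, so x_j still divides the monomial after one factor
      x_i is removed.\<close>
    have j: "j \<in> Poly_Mapping.keys ?m"
      using ij by (auto simp: in_keys_iff lookup_minus lookup_single)
    have "Poly_Mapping.keys ?m' \<subseteq> Poly_Mapping.keys m"
      by (auto simp: in_keys_iff lookup_minus)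
    then have "Poly_Mapping.single ?m' c \<in> polys n"
      using m(1) by (auto simp: polys_def)
    then have "mvar i * mvar j * Poly_Mapping.single ?m' c \<in> cycle_edge_ideal n"
      using G[OF ij(4)] by (rule mpoly.is_idealD(5)[OF J'])
    then show "Poly_Mapping.single m c \<in> cycle_edge_ideal n"
      by (simp only: single_eq_mvar_mult(1)[OF ij(1)] single_eq_mvar_mult(1)[OF j] mult.assoc)
  qed
qed

text \<open>This is the representation of \<open>a\<close> that the null-homotopy of multiplication
  by \<open>a\<close> on Koszul cochains requires.\<close>

lemma graded_max_ideal_memD:
  assumes "a \<in> (graded_max_ideal n :: 'k::field mpolynomial set)"
  shows "\<exists>r. a = (\<Sum>v\<in>{1..n}. mvar v * r v) \<and> (\<forall>v\<in>{1..n}. r v \<in> polys n)"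
proof -
  let ?L = "{a. \<exists>r. a = (\<Sum>v\<in>{1..n}. mvar v * r v) \<and> (\<forall>v\<in>{1..n}. r v \<in> polys n)} :: 'k mpolynomial set"
  have mem: "(\<Sum>v\<in>{1..n}. mvar v * r v) \<in> ?L" if "\<And>v. v \<in> {1..n} \<Longrightarrow> r v \<in> polys n" for r
    using that by blast
  have "mpoly.is_ideal n ?L"
    unfolding mpoly.is_ideal_def
  proof (intro conjI ballI)
    show "?L \<subseteq> polys n"
      by (auto intro!: mpoly.sum_mem mpoly.mult_mem mvar_mem)
    have "(\<Sum>v\<in>{1..n}. mvar v * 0) \<in> ?L"
      by (rule mem) (rule mpoly.zero_mem)
    then show "0 \<in> ?L"
      by (simp only: mult_zero_right sum.neutral_const)
  next
    fix a b :: "'k mpolynomial"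
    assume "a \<in> ?L" "b \<in> ?L"
    then obtain r s where rs: "a = (\<Sum>v\<in>{1..n}. mvar v * r v)" "\<forall>v\<in>{1..n}. r v \<in> polys n"
      "b = (\<Sum>v\<in>{1..n}. mvar v * s v)" "\<forall>v\<in>{1..n}. s v \<in> polys n"
      by blast
    have "(\<Sum>v\<in>{1..n}. mvar v * (r v + s v)) \<in> ?L"
      using rs by (intro mem mpoly.add_mem) auto
    then show "a + b \<in> ?L"
      by (simp only: rs distrib_left sum.distrib)
  next
    fix q a :: "'k mpolynomial"
    assume q: "q \<in> polys n" and "a \<in> ?L"
    then obtain r where r: "a = (\<Sum>v\<in>{1..n}. mvar v * r v)" "\<forall>v\<in>{1..n}. r v \<in> polys n"
      by blast
    have "(\<Sum>v\<in>{1..n}. mvar v * (q * r v)) \<in> ?L"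
      using r q by (intro mem mpoly.mult_mem) auto
    then show "q * a \<in> ?L"
      by (simp only: r sum_distrib_left mult.left_commute)
  qed
  moreover have "{mvar i | i. i \<in> {1..n}} \<subseteq> ?L"
  proof
    fix a :: "'k mpolynomial"
    assume "a \<in> {mvar i | i. i \<in> {1..n}}"
    then obtain i where i: "i \<in> {1..n}" "a = mvar i"
      by blast
    have "(\<Sum>v\<in>{1..n}. mvar v * (if v = i then 1 else 0)) \<in> ?L"
      by (intro mem) (simp add: mpoly.one_mem mpoly.zero_mem)
    then show "a \<in> ?L"
      using i by (simp add: if_distrib cong: if_cong)
  qed
  ultimately have "graded_max_ideal n \<subseteq> ?L"
    unfolding graded_max_ideal_def mpoly_ring_eq by (rule mpoly.genideal_subring_record_minimal)
  then show ?thesis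
    using assms by blast
qed

lemma sum_mvar_mem_graded_max_ideal:
  assumes "A \<subseteq> {1..n}"
  shows "(\<Sum>v\<in>A. mvar v) \<in> (graded_max_ideal n :: 'k::field mpolynomial set)"
proof -
  have "{mvar i | i. i \<in> {1..n}} \<subseteq> (polys n :: 'k mpolynomial set)"
    using mvar_mem by blast
  then have "mpoly.is_ideal n (graded_max_ideal n :: 'k mpolynomial set)"
    unfolding graded_max_ideal_def mpoly_ring_eq by (rule mpoly.is_ideal_genideal_subring_record)
  moreover have "mvar v \<in> graded_max_ideal n" if "v \<in> {1..n}" for v
    using that unfolding graded_max_ideal_def genideal_def by blast
  ultimately show ?thesis
    using assms by (metis (no_types, lifting) mpoly.is_ideal_sum subsetD)
qed

theorem proposition1p3:
  fixes n :: nat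
  assumes "n \<ge> 3"
  shows "depth (mpoly_ring n :: 'k::field mpolynomial ring) (graded_max_ideal n)
           (quot_module (regular_module (mpoly_ring n)) (cycle_edge_ideal n))
         = enat (nat \<lceil>(real n - 1) / 3\<rceil>)"
proof -
  \<comment> \<open>The floor of (n+1)/3 equals the ceiling of (n-1)/3; in this form d is accessible
    to linear arithmetic.\<close>
  define d where "d = Suc n div 3"
  have d: "3 * d \<le> Suc n" "n \<le> 3 * d + 1"
    unfolding d_def by presburger+
  have "nat \<lceil>(real n - 1) / 3\<rceil> = d"
    using d by (simp add: ceiling_unique[of "int d"] nat_eq_iff)
  let ?J = "monomial_ideal n (cycle_nonface n) :: 'k mpolynomial set"
  let ?m = "graded_max_ideal n :: 'k mpolynomial set"
  have J: "mpoly.is_ideal n ?J"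
    by (intro is_ideal_monomial_ideal mono_cycle_nonface)
  have mvar: "mvar ` {1..n} \<subseteq> (polys n :: 'k mpolynomial set)"
    using mvar_mem by blast
  have "mpoly.nonzero_cohomology n mvar {1..n} ?J d"
  proof (cases "n mod 3 = 2")
    case True
    then have "n = 3 * (d - 1) + 2" "Suc (d - 1) = d"
      using assms d by presburger+
    then show ?thesis
      using nonzero_cohomology_cycle_mod_2[of n "d - 1"] by metis
  next
    case False
    then have "n = 3 * d \<or> n = 3 * d + 1" "d \<ge> 1"
      using assms d by presburger+
    then show ?thesis
      by (rule nonzero_cohomology_cycle_mod_0_1)
  qed
  then have upper: "length as \<le> d" if "set as \<subseteq> ?m" "mpoly.weakly_regular n ?J as" for as
    using that graded_max_ideal_memD
    by (intro mpoly.weakly_regular_length_le[OF _ J mvar]) blast+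
  define as :: "'k mpolynomial list" where
    "as = map (\<lambda>i. \<Sum>v\<in>cycle_form_support n i. mvar v) [0..<d]"
  have support: "cycle_form_support n i \<subseteq> {1..n}" if "i < d" for i
  proof (cases "n mod 3 = 2")
    case True
    then show ?thesis
      using assms by (auto simp: cycle_form_support_def)
  next
    case False
    then have "3 * d \<le> n"
      using d by presburger
    then show ?thesis
      using False that by (auto simp: cycle_form_support_def)
  qed
  have support_mem: "v \<in> {1..n}" if "i < d" "v \<in> cycle_form_support n i" for i v
    using support[OF that(1)] that(2) by blast
  have as_m: "set as \<subseteq> ?m"
    using sum_mvar_mem_graded_max_ideal[OF support] by (auto simp: as_def)
  have as_S: "set as \<subseteq> polys n"
    unfolding as_def set_map image_subset_iff
    by (intro ballI mpoly.sum_mem mvar_mem support_mem) auto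
  have "mpoly.weakly_regular n ?J as"
  proof (rule weakly_regular_cycle[OF assms as_S])
    fix W assume "\<And>c. c \<in> {1..n - 1} \<Longrightarrow>
      \<exists>u\<in>{1..n} - W. u \<le> Suc c \<and> c \<le> Suc u \<or> c = 1 \<and> u = n"
    then show "mpoly.weakly_regular n (monomial_ideal n (\<lambda>A. A \<inter> W \<noteq> {})) as"
      unfolding as_def
      by (intro weakly_regular_mod_variables support cycle_forms_independent[OF assms d]) auto
  qed
  moreover have "1 \<notin> foldl (mpoly.adjoin n) ?J as"
  proof -
    \<comment> \<open>The polynomials without constant term form a proper ideal containing the edge
      ideal and all the forms.\<close>
    let ?M = "monomial_ideal n (\<lambda>A. A \<noteq> {}) :: 'k mpolynomial set"
    have M: "mpoly.is_ideal n ?M"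
      by (intro is_ideal_monomial_ideal) (auto simp: mono_def le_bool_def)
    have mvar_M: "mvar v \<in> ?M" if "v \<in> {1..n}" for v
      unfolding mvar_def using that by (intro single_mem_monomial_ideal) auto
    have "set as \<subseteq> ?M"
      unfolding as_def set_map image_subset_iff
      by (intro ballI mpoly.is_ideal_sum[OF M] mvar_M support_mem) auto
    moreover have "?J \<subseteq> ?M"
      by (auto simp: monomial_ideal_def cycle_nonface_def)
    ultimately have "foldl (mpoly.adjoin n) ?J as \<subseteq> ?M"
      by (intro mpoly.foldl_adjoin_subset[OF M])
    moreover have "1 \<notin> ?M"
      by (simp add: monomial_ideal_def)
    ultimately show ?thesis
      by blast
  qed
  ultimately have regular: "regular_sequence (mpoly.subring_record n) (mpoly.quotient n ?J) as"
    using as_S by (simp add: mpoly.regular_sequence_quotient_iff[OF J])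
  have "depth (mpoly.subring_record n) ?m (mpoly.quotient n ?J) = enat d"
    unfolding depth_def
  proof (rule antisym)
    show "Sup {enat (length as) | as. set as \<subseteq> ?m \<and>
        regular_sequence (mpoly.subring_record n) (mpoly.quotient n ?J) as} \<le> enat d"
      using upper by (auto intro!: Sup_least simp: mpoly.regular_sequence_quotient_iff[OF J])
    have "length as = d"
      by (simp add: as_def)
    then show "enat d \<le> Sup {enat (length as) | as. set as \<subseteq> ?m \<and>
        regular_sequence (mpoly.subring_record n) (mpoly.quotient n ?J) as}"
      using as_m regular by (intro Sup_upper) blast
  qed
  then show ?thesis
    by (simp add: cycle_edge_ideal_eq[OF assms] mpoly_ring_eq \<open>nat _ = d\<close>)
qed

end
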